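(* Let $1\le n\le m$, let $(M,\tau)$ be a tracial von Neumann algebra generated by self-adjoint elements $y_1,\dots,y_m$, i.e. $M=W^*(y_1,\dots,y_m)$, and let $y=y^*\in\operatorname{Alg}(y_1,\dots,y_n)\subset M$ be a non-constant polynomial in $y_1,\dots,y_n$. Assume that there exists a dual system to $y_1,\dots,y_m$, i.e. operators $R_j\in B(L^2(M))$, $1\le j\le m$, such that $[R_j,y_k]=\delta_{j=k}P_1$ for all $1\le j,k\le m$, where $P_1$ is the orthogonal projection onto $\mathbb{C}1\subset L^2(M)$. Suppose further that for each $j$, with $\mathcal{N}_j$ the number operator corresponding to $y_j$, there is a scalar $\lambda_j$ with $\mathcal{N}_j(y)=\lambda_jy$. Then the spectral measure of $y$ is absolutely continuous with respect to Lebesgue measure.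
   Context: A tracial von Neumann algebra ($W^*$-probability space) $(M,\tau)$ is a von Neumann algebra with a faithful normal tracial state $\tau$; $L^2(M)=L^2(M,\tau)$ and $M$ acts on it by left multiplication. $\operatorname{Alg}(y_1,\dots,y_n)$ is the unital algebra generated by $y_1,\dots,y_n$. $[A,B]=AB-BA$; $\delta_{j=k}$ is $1$ if $j=k$ and $0$ otherwise. The elements $y_1,\dots,y_m$ (which admit a dual system) are algebraically free, so that elements of $\operatorname{Alg}(y_1,\dots,y_m)$ are identified with non-commutative polynomials; the number operator $\mathcal{N}_j$ is the linear map on $\operatorname{Alg}(y_1,\dots,y_m)$ that multiplies each monomial by its degree in $y_j$ (the number of occurrences of $y_j$ in it). The spectral measure of $y$ is the compactly supported probability measure $\mu$ on $\mathbb{R}$ with $\int t^k\,d\mu(t)=\tau(y^k)$ for all $k\ge0$. *)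

theory Defs
  imports "HOL-Probability.Probability" "HOL-Library.Poly_Mapping"
begin

section \<open>Complex Hilbert spaces and their bounded operators\<close>

text \<open>The complex structure is put on top of \<^class>\<open>real_inner\<close>, whose norm, metric and
  topology are reused. Inner products are linear in the second argument.\<close>

class complex_inner = real_inner +
  fixes scaleC :: "complex \<Rightarrow> 'a \<Rightarrow> 'a" (infixr \<open>*\<^sub>C\<close> 75)
    and cinner :: "'a \<Rightarrow> 'a \<Rightarrow> complex"
  assumes scaleC_add_right: "a *\<^sub>C (x + y) = a *\<^sub>C x + a *\<^sub>C y"
    and scaleC_add_left: "(a + b) *\<^sub>C x = a *\<^sub>C x + b *\<^sub>C x"
    and scaleC_scaleC: "a *\<^sub>C b *\<^sub>C x = (a * b) *\<^sub>C x"
    and scaleR_eq_scaleC: "r *\<^sub>R x = complex_of_real r *\<^sub>C x"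
    and cinner_commute: "cinner x y = cnj (cinner y x)"
    and cinner_add_right: "cinner x (y + z) = cinner x y + cinner x z"
    and cinner_scaleC_right: "cinner x (a *\<^sub>C y) = a * cinner x y"
    and inner_eq_Re_cinner: "inner x y = Re (cinner x y)"

class chilbert_space = complex_inner + complete_space

definition bounded_clinear :: "('a::complex_inner \<Rightarrow> 'b::complex_inner) \<Rightarrow> bool" where
  "bounded_clinear f \<longleftrightarrow> bounded_linear f \<and> (\<forall>c x. f (c *\<^sub>C x) = c *\<^sub>C f x)"

type_synonym 'a operator = "'a \<Rightarrow> 'a"

definition cadjoint :: "'a::chilbert_space operator \<Rightarrow> 'a operator" where
  "cadjoint A = (THE B. \<forall>u v. cinner (A u) v = cinner u (B v))"

definition op_le :: "'a::chilbert_space operator \<Rightarrow> 'a operator \<Rightarrow> bool" where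
  "op_le A B \<longleftrightarrow> (\<forall>v. cinner v (B v - A v) \<in> \<real>\<^sub>\<ge>\<^sub>0)"

definition commutator :: "'a::chilbert_space operator \<Rightarrow> 'a operator \<Rightarrow> 'a operator" where
  "commutator A B = (\<lambda>v. A (B v) - B (A v))"

text \<open>The orthogonal projection onto the line spanned by a vector of norm one.\<close>

definition line_projection :: "'a::chilbert_space \<Rightarrow> 'a operator" where
  "line_projection e = (\<lambda>v. cinner e v *\<^sub>C e)"


section \<open>Tracial von Neumann algebras\<close>

definition commutant :: "'a::chilbert_space operator set \<Rightarrow> 'a operator set" where
  "commutant S = {T. bounded_clinear T \<and> (\<forall>A\<in>S. T \<circ> A = A \<circ> T)}"

text \<open>A set that equals its bicommutant automatically is a unital subalgebra.\<close>

definition von_neumann_algebra :: "'a::chilbert_space operator set \<Rightarrow> bool" where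
  "von_neumann_algebra M \<longleftrightarrow>
     (\<forall>A\<in>M. bounded_clinear A) \<and> (\<forall>A\<in>M. cadjoint A \<in> M) \<and> commutant (commutant M) = M"

definition vN_generated :: "'a::chilbert_space operator set \<Rightarrow> 'a operator set" where
  "vN_generated S = \<Inter>{N. von_neumann_algebra N \<and> S \<subseteq> N}"

definition selfadjoint_part :: "'a::chilbert_space operator set \<Rightarrow> 'a operator set" where
  "selfadjoint_part M = {A\<in>M. cadjoint A = A}"

text \<open>Normality: suprema of upward directed families of self-adjoint elements are preserved.\<close>

definition normal_on :: "'a::chilbert_space operator set \<Rightarrow> ('a operator \<Rightarrow> complex) \<Rightarrow> bool" where
  "normal_on M \<tau> \<longleftrightarrow> (\<forall>D S.
     D \<subseteq> selfadjoint_part M \<and> D \<noteq> {} \<and>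
     (\<forall>A\<in>D. \<forall>B\<in>D. \<exists>C\<in>D. op_le A C \<and> op_le B C) \<and>
     S \<in> selfadjoint_part M \<and> (\<forall>A\<in>D. op_le A S) \<and>
     (\<forall>T\<in>selfadjoint_part M. (\<forall>A\<in>D. op_le A T) \<longrightarrow> op_le S T)
     \<longrightarrow> Re (\<tau> S) = (SUP A\<in>D. Re (\<tau> A)))"

definition faithful_normal_tracial_state ::
    "'a::chilbert_space operator set \<Rightarrow> ('a operator \<Rightarrow> complex) \<Rightarrow> bool" where
  "faithful_normal_tracial_state M \<tau> \<longleftrightarrow>
     (\<forall>A\<in>M. \<forall>B\<in>M. \<tau> (\<lambda>v. A v + B v) = \<tau> A + \<tau> B) \<and>
     (\<forall>A\<in>M. \<forall>c. \<tau> (\<lambda>v. c *\<^sub>C A v) = c * \<tau> A) \<and>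
     \<tau> id = 1 \<and>
     (\<forall>A\<in>M. \<tau> (cadjoint A \<circ> A) \<in> \<real>\<^sub>\<ge>\<^sub>0) \<and>
     (\<forall>A\<in>M. \<tau> (cadjoint A \<circ> A) = 0 \<longrightarrow> A = (\<lambda>v. 0)) \<and>
     (\<forall>A\<in>M. \<forall>B\<in>M. \<tau> (A \<circ> B) = \<tau> (B \<circ> A)) \<and>
     normal_on M \<tau>"

definition tracial_von_neumann_algebra ::
    "'a::chilbert_space operator set \<Rightarrow> ('a operator \<Rightarrow> complex) \<Rightarrow> bool" where
  "tracial_von_neumann_algebra M \<tau> \<longleftrightarrow>
     von_neumann_algebra M \<and> faithful_normal_tracial_state M \<tau>"

text \<open>\<^term>\<open>L2_representation M \<tau> \<Lambda> \<pi>\<close>: the Hilbert space \<open>'h\<close> is \<open>L\<^sup>2(M, \<tau>)\<close>, that is, the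
  completion of \<open>M\<close> for the inner product \<open>\<tau> (A\<^sup>* B)\<close>. Here \<open>\<Lambda>\<close> is the canonical map
  of \<open>M\<close> into its completion, and \<open>\<pi>\<close> is the action of \<open>M\<close> by left multiplication. These data
  are unique up to a unitary. The element \<open>1\<close> of \<open>L\<^sup>2(M, \<tau>)\<close> is \<^term>\<open>\<Lambda> id\<close>.\<close>

definition L2_representation ::
    "'k::chilbert_space operator set \<Rightarrow> ('k operator \<Rightarrow> complex) \<Rightarrow>
     ('k operator \<Rightarrow> 'h::chilbert_space) \<Rightarrow> ('k operator \<Rightarrow> 'h operator) \<Rightarrow> bool" where
  "L2_representation M \<tau> \<Lambda> \<pi> \<longleftrightarrow>
     (\<forall>A\<in>M. \<forall>B\<in>M. \<Lambda> (\<lambda>v. A v + B v) = \<Lambda> A + \<Lambda> B) \<and>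
     (\<forall>A\<in>M. \<forall>c. \<Lambda> (\<lambda>v. c *\<^sub>C A v) = c *\<^sub>C \<Lambda> A) \<and>
     (\<forall>A\<in>M. \<forall>B\<in>M. cinner (\<Lambda> A) (\<Lambda> B) = \<tau> (cadjoint A \<circ> B)) \<and>
     closure (\<Lambda> ` M) = UNIV \<and>
     (\<forall>A\<in>M. bounded_clinear (\<pi> A) \<and> (\<forall>B\<in>M. \<pi> A (\<Lambda> B) = \<Lambda> (A \<circ> B)))"


section \<open>Polynomials in operators and number operators\<close>

text \<open>The unital algebra generated by a set of operators.\<close>

inductive_set Alg :: "'a::chilbert_space operator set \<Rightarrow> 'a operator set" for S where
  Alg_one: "id \<in> Alg S"
| Alg_gen: "A \<in> S \<Longrightarrow> A \<in> Alg S"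
| Alg_add: "A \<in> Alg S \<Longrightarrow> B \<in> Alg S \<Longrightarrow> (\<lambda>v. A v + B v) \<in> Alg S"
| Alg_scaleC: "A \<in> Alg S \<Longrightarrow> (\<lambda>v. c *\<^sub>C A v) \<in> Alg S"
| Alg_mult: "A \<in> Alg S \<Longrightarrow> B \<in> Alg S \<Longrightarrow> A \<circ> B \<in> Alg S"

text \<open>A non-commutative polynomial is a finitely supported function on words; the word
  \<open>[i\<^sub>1, \<dots>, i\<^sub>k]\<close> stands for the monomial with factors number \<open>i\<^sub>1\<close> to \<open>i\<^sub>k\<close>, in this order.\<close>

type_synonym ncpoly = "nat list \<Rightarrow>\<^sub>0 complex"

definition ncpolys :: "nat set \<Rightarrow> ncpoly set" where
  "ncpolys J = {p. \<forall>w\<in>Poly_Mapping.keys p. set w \<subseteq> J}"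

definition nc_monomial :: "(nat \<Rightarrow> 'a::chilbert_space operator) \<Rightarrow> nat list \<Rightarrow> 'a operator" where
  "nc_monomial y w = foldr (\<lambda>j A. y j \<circ> A) w id"

definition nc_eval :: "(nat \<Rightarrow> 'a::chilbert_space operator) \<Rightarrow> ncpoly \<Rightarrow> 'a operator" where
  "nc_eval y p =
     (\<lambda>v. \<Sum>w\<in>Poly_Mapping.keys p. Poly_Mapping.lookup p w *\<^sub>C nc_monomial y w v)"

definition nc_number :: "nat \<Rightarrow> ncpoly \<Rightarrow> ncpoly" where
  "nc_number j p = Poly_Mapping.mapp (\<lambda>w c. of_nat (count_list w j) * c) p"

text \<open>The number operator of the \<open>j\<close>-th generator on the algebra generated by \<open>y 1, \<dots>, y m\<close>,
  whose elements are identified with polynomials. The description is definite when the generators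
  are algebraically free, in particular when they admit a dual system.\<close>

definition number_operator ::
    "(nat \<Rightarrow> 'a::chilbert_space operator) \<Rightarrow> nat \<Rightarrow> nat \<Rightarrow> 'a operator \<Rightarrow> 'a operator" where
  "number_operator y m j A =
     (THE B. \<exists>p\<in>ncpolys {1..m}. A = nc_eval y p \<and> B = nc_eval y (nc_number j p))"


section \<open>Dual systems and spectral measures\<close>

text \<open>A dual system on the Hilbert space \<open>'h\<close>, on which the generators act as \<open>x 1, \<dots>, x m\<close>;
  \<open>e\<close> is the unit vector representing \<open>1\<close>.\<close>

definition dual_system ::
    "(nat \<Rightarrow> 'h::chilbert_space operator) \<Rightarrow> 'h \<Rightarrow> nat \<Rightarrow> (nat \<Rightarrow> 'h operator) \<Rightarrow> bool" where
  "dual_system x e m R \<longleftrightarrow>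
     (\<forall>j\<in>{1..m}. bounded_clinear (R j)) \<and>
     (\<forall>j\<in>{1..m}. \<forall>k\<in>{1..m}.
        commutator (R j) (x k) = (if j = k then line_projection e else (\<lambda>v. 0)))"

definition is_spectral_measure ::
    "('a::chilbert_space operator \<Rightarrow> complex) \<Rightarrow> 'a operator \<Rightarrow> real measure \<Rightarrow> bool" where
  "is_spectral_measure \<tau> A \<mu> \<longleftrightarrow>
     prob_space \<mu> \<and> sets \<mu> = sets borel \<and>
     (\<exists>K. compact K \<and> emeasure \<mu> (- K) = 0) \<and>
     (\<forall>k. complex_of_real (\<integral>t. t ^ k \<partial>\<mu>) = \<tau> (A ^^ k))"

end

theory Submission
  imports Defs "HOL-Computational_Algebra.Polynomial"
begin

text \<open>Write \<open>T\<close> and \<open>x\<^sub>j\<close> for \<open>y\<close> and \<open>y\<^sub>j\<close> acting on \<open>L\<^sup>2(M)\<close>, \<open>e\<close> for the vector \<open>1\<close> and \<open>\<mu>\<close> for the spectral measure. Since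
  \<open>[R\<^sub>j, x\<^sub>k]\<close> is \<open>0\<close> or the projection onto \<open>e\<close>, the commutator of \<open>R\<^sub>j\<close> with a polynomial is a finite-rank
  operator: an occurrence \<open>a x\<^sub>j b\<close> of the letter \<open>j\<close> in a monomial contributes
  \<open>v \<mapsto> \<langle>e, b v\<rangle> a e\<close>.

  Away from \<open>0\<close>, absolute continuity comes from a trace estimate. Let \<open>S = p(T)\<close>, where \<open>p\<close> imitates the
  indicator of a short interval around \<open>s\<close>. Then \<open>S [R\<^sub>j, T] S = S R\<^sub>j (T - s) S - S (T - s) R\<^sub>j S\<close> has norm at
  most a constant times the length of the interval. Its rank is bounded independently of \<open>p\<close>, so the same holds for
  its trace against any fixed bounded operator. Taking for this operator the right multiplication by \<open>x\<^sub>j\<close>,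
  which commutes with the left multiplications, and using that \<open>\<langle>e, \<cdot> e\<rangle>\<close> is a trace, one finds that this trace is
  \<open>\<tau>(p(y)\<^sup>2 \<N>\<^sub>j(y)) = \<lambda>\<^sub>j \<integral> p(t)\<^sup>2 t d\<mu>(t)\<close> (lemma \<open>commutator_estimate\<close>). Hence \<open>t d\<mu>(t)\<close> has a bounded
  density as soon as some \<open>\<lambda>\<^sub>j\<close> is nonzero. No spectral theorem is involved: the norm of \<open>p(T)\<close> is bounded by
  the supremum of \<open>\<bar>p\<bar>\<close> on the support of \<open>\<mu>\<close> by looking at the moments (lemma \<open>opoly_norm_le\<close>).

  At \<open>0\<close> one needs that \<open>y\<close> is not a zero divisor. In fact a nonzero polynomial in the \<open>x\<^sub>j\<close> has trivial
  kernel (lemma \<open>polynomial_kernel_trivial\<close>), by induction on the degree: if \<open>E\<close> and \<open>F\<close> project onto the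
  kernels of \<open>A\<close> and \<open>A\<^sup>*\<close>, then \<open>F [R\<^sub>j, A] E = 0\<close> says that \<open>F\<close> annihilates polynomials of smaller degree, and
  \<open>E\<close> and \<open>F\<close> have the same trace. The same result shows that the \<open>x\<^sub>j\<close> are algebraically free, so that the
  number operators make sense, and by comparison of coefficients that every \<open>\<lambda>\<^sub>j\<close> is the degree in \<open>x\<^sub>j\<close>; one
  of these is nonzero because \<open>y\<close> is not constant.\<close>


section \<open>Complex inner product spaces\<close>

lemma cinner_add_left: "cinner (x + y) z = cinner x z + cinner y (z::'a::complex_inner)"
  by (metis cinner_add_right cinner_commute complex_cnj_add)

lemma cinner_scaleC_left: "cinner (a *\<^sub>C x) z = cnj a * cinner x (z::'a::complex_inner)"
  by (metis cinner_commute cinner_scaleC_right complex_cnj_mult)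

lemma scaleC_1 [simp]: "1 *\<^sub>C x = (x::'a::complex_inner)"
  by (metis of_real_1 scaleR_eq_scaleC scaleR_one)

lemma scaleC_0_left [simp]: "0 *\<^sub>C x = (0::'a::complex_inner)"
  by (metis of_real_0 scaleR_eq_scaleC scale_zero_left)

lemma scaleC_0_right [simp]: "a *\<^sub>C 0 = (0::'a::complex_inner)"
  by (metis add_cancel_right_right scaleC_add_right)

lemma scaleC_minus_left: "(- a) *\<^sub>C x = - (a *\<^sub>C (x::'a::complex_inner))"
  by (metis add.right_inverse add_eq_0_iff scaleC_0_left scaleC_add_left)

lemma scaleC_minus_right: "a *\<^sub>C (- x) = - (a *\<^sub>C (x::'a::complex_inner))"
  by (metis add.right_inverse add_eq_0_iff scaleC_0_right scaleC_add_right)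

lemma scaleC_diff_right: "a *\<^sub>C (x - y) = a *\<^sub>C x - a *\<^sub>C (y::'a::complex_inner)"
  by (metis diff_conv_add_uminus scaleC_add_right scaleC_minus_right)

lemma scaleC_diff_left: "(a - b) *\<^sub>C x = a *\<^sub>C x - b *\<^sub>C (x::'a::complex_inner)"
  by (metis diff_conv_add_uminus scaleC_add_left scaleC_minus_left)

lemma scaleC_sum_right: "a *\<^sub>C (\<Sum>i\<in>I. f i) = (\<Sum>i\<in>I. a *\<^sub>C (f i :: 'a::complex_inner))"
  by (induction I rule: infinite_finite_induct) (auto simp: scaleC_add_right)

lemma scaleC_sum_left: "(\<Sum>i\<in>I. f i) *\<^sub>C x = (\<Sum>i\<in>I. f i *\<^sub>C (x :: 'a::complex_inner))"
  by (induction I rule: infinite_finite_induct) (auto simp: scaleC_add_left)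

lemma scaleC_eq_0_iff: "a *\<^sub>C x = 0 \<longleftrightarrow> a = 0 \<or> x = (0::'a::complex_inner)"
proof
  assume "a *\<^sub>C x = 0"
  then have "(inverse a * a) *\<^sub>C x = 0"
    by (metis scaleC_0_right scaleC_scaleC)
  then show "a = 0 \<or> x = 0" by (cases "a = 0") auto
qed auto

lemma cinner_0_right [simp]: "cinner x 0 = (0::complex)"
  by (metis add_cancel_right_right cinner_add_right)

lemma cinner_0_left [simp]: "cinner 0 x = (0::complex)"
  by (metis cinner_0_right cinner_commute complex_cnj_zero)

lemma cinner_minus_right: "cinner x (- y) = - cinner x (y::'a::complex_inner)"
  by (metis add.right_inverse add_eq_0_iff cinner_0_right cinner_add_right)

lemma cinner_minus_left: "cinner (- x) y = - cinner x (y::'a::complex_inner)"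
  by (metis add.right_inverse add_eq_0_iff cinner_0_left cinner_add_left)

lemma cinner_diff_right: "cinner x (y - z) = cinner x y - cinner x (z::'a::complex_inner)"
  by (metis cinner_add_right cinner_minus_right diff_conv_add_uminus)

lemma cinner_diff_left: "cinner (x - y) z = cinner x z - cinner y (z::'a::complex_inner)"
  by (metis cinner_add_left cinner_minus_left diff_conv_add_uminus)

lemma cinner_sum_right: "cinner x (\<Sum>i\<in>I. f i) = (\<Sum>i\<in>I. cinner x (f i :: 'a::complex_inner))"
  by (induction I rule: infinite_finite_induct) (auto simp: cinner_add_right)

lemma cinner_sum_left: "cinner (\<Sum>i\<in>I. f i) x = (\<Sum>i\<in>I. cinner (f i) (x :: 'a::complex_inner))"
  by (induction I rule: infinite_finite_induct) (auto simp: cinner_add_left)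

lemma cinner_scaleR_right: "cinner x (r *\<^sub>R y) = of_real r * cinner x (y::'a::complex_inner)"
  by (simp add: scaleR_eq_scaleC cinner_scaleC_right)

lemma cinner_scaleR_left: "cinner (r *\<^sub>R x) y = of_real r * cinner x (y::'a::complex_inner)"
  by (simp add: scaleR_eq_scaleC cinner_scaleC_left)

lemma cinner_self: "cinner x x = complex_of_real ((norm (x::'a::complex_inner))\<^sup>2)"
proof (rule complex_eqI)
  show "Re (cinner x x) = Re (complex_of_real ((norm x)\<^sup>2))"
    by (simp add: inner_eq_Re_cinner[symmetric] power2_norm_eq_inner del: of_real_power)
  show "Im (cinner x x) = Im (complex_of_real ((norm x)\<^sup>2))"
    using arg_cong[OF cinner_commute[of x x], of Im] by (simp del: of_real_power)
qed

lemma norm_scaleC: "norm (a *\<^sub>C x) = cmod a * norm (x::'a::complex_inner)"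
proof -
  have "complex_of_real ((norm (a *\<^sub>C x))\<^sup>2) = a * cnj a * of_real ((norm x)\<^sup>2)"
    by (metis cinner_scaleC_left cinner_scaleC_right cinner_self mult.assoc mult.left_commute)
  also have "\<dots> = of_real ((cmod a * norm x)\<^sup>2)"
    by (simp add: complex_norm_square[symmetric] power_mult_distrib)
  finally have "(norm (a *\<^sub>C x))\<^sup>2 = (cmod a * norm x)\<^sup>2"
    using of_real_eq_iff by blast
  then show ?thesis by (simp add: power2_eq_iff_nonneg)
qed

text \<open>Multiplying one vector by a phase makes the complex inner product real, which reduces the
  inequality to the real one.\<close>

lemma cinner_Cauchy_Schwarz: "cmod (cinner u v) \<le> norm u * norm (v::'a::complex_inner)"
proof (cases "cinner u v = 0")
  case False
  define a where "a = cnj (cinner u v) / cmod (cinner u v)"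
  have "cinner u (a *\<^sub>C v) = of_real (cmod (cinner u v))"
    using False by (simp add: a_def cinner_scaleC_right complex_norm_square[symmetric]
        power2_eq_square mult.commute)
  then have "cmod (cinner u v) = inner u (a *\<^sub>C v)"
    by (simp add: inner_eq_Re_cinner)
  also have "\<dots> \<le> norm u * norm (a *\<^sub>C v)" by (rule norm_cauchy_schwarz)
  also have "norm (a *\<^sub>C v) = norm v"
    using False by (simp add: norm_scaleC a_def norm_divide)
  finally show ?thesis .
qed auto

lemma bounded_bilinear_cinner:
  "bounded_bilinear (cinner :: 'a::complex_inner \<Rightarrow> 'a \<Rightarrow> complex)"
proof
  show "\<exists>K. \<forall>(a::'a) b. norm (cinner a b) \<le> norm a * norm b * K"
    using cinner_Cauchy_Schwarz by (metis mult.right_neutral)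
qed (auto simp: cinner_add_left cinner_add_right cinner_scaleR_left cinner_scaleR_right scaleR_conv_of_real)

lemmas tendsto_cinner [tendsto_intros] = bounded_bilinear.tendsto[OF bounded_bilinear_cinner]
lemmas continuous_on_cinner [continuous_intros] =
  bounded_bilinear.continuous_on[OF bounded_bilinear_cinner]

lemma cinner_eq_zeroI:
  assumes "\<And>u. cinner u v = 0" shows "v = (0::'a::complex_inner)"
  using assms[of v] by (simp add: cinner_self)

lemma cinner_extI:
  assumes "\<And>u. cinner u v = cinner u w" shows "v = (w::'a::complex_inner)"
  using cinner_eq_zeroI[of "v - w"] assms by (simp add: cinner_diff_right)


section \<open>Bounded operators\<close>

lemma bounded_clinearI:
  assumes "\<And>x y. f (x + y) = f x + f y" "\<And>c x. f (c *\<^sub>C x) = c *\<^sub>C f x"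
    "\<And>x. norm (f x) \<le> norm x * K"
  shows "bounded_clinear f"
  unfolding bounded_clinear_def
  using assms by (auto intro!: bounded_linear_intro[where K=K] simp: scaleR_eq_scaleC)

lemma
  assumes "bounded_clinear f"
  shows bounded_clinear_add: "f (x + y) = f x + f y"
    and bounded_clinear_diff: "f (x - y) = f x - f y"
    and bounded_clinear_minus: "f (- x) = - f x"
    and bounded_clinear_zero: "f 0 = 0"
    and bounded_clinear_scaleC: "f (c *\<^sub>C x) = c *\<^sub>C f x"
    and bounded_clinear_scaleR: "f (r *\<^sub>R x) = r *\<^sub>R f x"
    and bounded_clinear_sum: "f (\<Sum>i\<in>I. g i) = (\<Sum>i\<in>I. f (g i))"
    and bounded_clinear_continuous: "continuous_on S f"
  using assms unfolding bounded_clinear_def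
  by (auto simp: linear_simps linear_sum bounded_linear.linear linear_continuous_on)

lemma bounded_clinear_tendsto:
  "bounded_clinear f \<Longrightarrow> (g \<longlongrightarrow> a) F \<Longrightarrow> ((\<lambda>x. f (g x)) \<longlongrightarrow> f a) F"
  unfolding bounded_clinear_def using bounded_linear.tendsto by blast

lemma bounded_clinear_bound:
  assumes "bounded_clinear f"
  obtains K where "0 < K" "\<And>x. norm (f x) \<le> K * norm x"
  using assms unfolding bounded_clinear_def
  by (metis bounded_linear.pos_bounded mult.commute)

lemma bounded_clinear_id: "bounded_clinear id"
  by (rule bounded_clinearI[where K=1]) auto

lemma bounded_clinear_const_scaleC:
  assumes f: "bounded_clinear f" shows "bounded_clinear (\<lambda>v. c *\<^sub>C f v)"
proof -
  obtain K where K: "\<And>x. norm (f x) \<le> K * norm x" using bounded_clinear_bound[OF f] by metis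
  have "norm (c *\<^sub>C f x) \<le> norm x * (cmod c * K)" for x
    using mult_left_mono[OF K, of "cmod c" x] by (simp add: norm_scaleC ac_simps)
  then show ?thesis
    by (auto intro!: bounded_clinearI simp: bounded_clinear_add[OF f] bounded_clinear_scaleC[OF f]
        scaleC_add_right scaleC_scaleC mult.commute)
qed

lemma bounded_clinear_plus:
  assumes "bounded_clinear f" "bounded_clinear g"
  shows "bounded_clinear (\<lambda>v. f v + g v)"
  using assms unfolding bounded_clinear_def
  by (auto intro: bounded_linear_add simp: scaleC_add_right)

lemma bounded_clinear_comp:
  assumes "bounded_clinear f" "bounded_clinear g"
  shows "bounded_clinear (f \<circ> g)"
  using assms unfolding bounded_clinear_def
  by (auto intro: bounded_linear_compose simp: o_def)

lemma bounded_clinear_eq_on_dense: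
  fixes f g :: "'a::complex_inner \<Rightarrow> 'b::complex_inner"
  assumes f: "bounded_clinear f" and g: "bounded_clinear g" and dense: "closure S = UNIV"
    and eq: "\<And>s. s \<in> S \<Longrightarrow> f s = g s"
  shows "f = g"
proof -
  have "closed {x. f x = g x}"
    by (intro closed_Collect_eq bounded_clinear_continuous f g)
  then have "closure S \<subseteq> {x. f x = g x}" by (rule closure_minimal[rotated]) (use eq in auto)
  with dense show ?thesis by auto
qed

lemma cinner_eq_on_dense:
  fixes A B :: "'a::complex_inner \<Rightarrow> 'a"
  assumes A: "bounded_clinear A" and B: "bounded_clinear B" and dense: "closure S = UNIV"
    and eq: "\<And>s t. s \<in> S \<Longrightarrow> t \<in> S \<Longrightarrow> cinner (A s) t = cinner s (B t)"
  shows "cinner (A u) v = cinner u (B v)"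
proof -
  have 1: "cinner (A s) v = cinner s (B v)" if "s \<in> S" for s v
  proof -
    have "closed {v. cinner (A s) v = cinner s (B v)}"
      by (intro closed_Collect_eq continuous_intros bounded_clinear_continuous B)
    then have "closure S \<subseteq> {v. cinner (A s) v = cinner s (B v)}"
      by (rule closure_minimal[rotated]) (use eq that in auto)
    with dense show ?thesis by auto
  qed
  have "closed {u. cinner (A u) v = cinner u (B v)}"
    by (intro closed_Collect_eq continuous_intros bounded_clinear_continuous A)
  then have "closure S \<subseteq> {u. cinner (A u) v = cinner u (B v)}"
    by (rule closure_minimal[rotated]) (use 1 in auto)
  with dense show ?thesis by auto
qed

lemma bounded_clinear_extension:
  fixes g :: "'a::chilbert_space \<Rightarrow> 'b::chilbert_space"
  assumes dense: "closure S = UNIV"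
    and S_add: "\<And>s t. s \<in> S \<Longrightarrow> t \<in> S \<Longrightarrow> s + t \<in> S"
    and S_scale: "\<And>c s. s \<in> S \<Longrightarrow> c *\<^sub>C s \<in> S"
    and g_add: "\<And>s t. s \<in> S \<Longrightarrow> t \<in> S \<Longrightarrow> g (s + t) = g s + g t"
    and g_scale: "\<And>c s. s \<in> S \<Longrightarrow> g (c *\<^sub>C s) = c *\<^sub>C g s"
    and g_bound: "\<And>s. s \<in> S \<Longrightarrow> norm (g s) \<le> K * norm s"
  obtains T where "bounded_clinear T" "\<And>s. s \<in> S \<Longrightarrow> T s = g s"
proof -
  have g_diff: "g (s - t) = g s - g t" and S_diff: "s - t \<in> S" if "s \<in> S" "t \<in> S" for s t
    using S_add[of s "(-1) *\<^sub>C t"] g_add[of s "(-1) *\<^sub>C t"] S_scale[of t "-1"] g_scale[of t "-1"] that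
    by (auto simp: scaleC_minus_left)
  have "uniformly_continuous_on S g"
    unfolding uniformly_continuous_on_def
  proof (intro allI impI)
    fix \<epsilon> :: real assume \<epsilon>: "\<epsilon> > 0"
    have "dist (g t) (g s) < \<epsilon>" if "s \<in> S" "t \<in> S" "dist t s < \<epsilon> / (\<bar>K\<bar> + 1)" for s t
    proof -
      have "norm (g t - g s) \<le> K * norm (t - s)" using that g_bound[OF S_diff] g_diff by metis
      also have "\<dots> \<le> (\<bar>K\<bar> + 1) * norm (t - s)" by (intro mult_right_mono) auto
      also have "\<dots> < \<epsilon>"
        using that(3) by (simp add: dist_norm pos_less_divide_eq mult.commute)
      finally show ?thesis by (simp add: dist_norm)
    qed
    then show "\<exists>d>0. \<forall>x\<in>S. \<forall>x'\<in>S. dist x' x < d \<longrightarrow> dist (g x') (g x) < \<epsilon>"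
      using \<epsilon> by (intro exI[of _ "\<epsilon> / (\<bar>K\<bar> + 1)"]) auto
  qed
  then obtain T where uT: "uniformly_continuous_on (closure S) T" and Tg: "\<And>s. s \<in> S \<Longrightarrow> g s = T s"
    using uniformly_continuous_on_extension_on_closure by metis
  then have cT: "continuous_on UNIV T"
    using dense uniformly_continuous_imp_continuous by metis
  have cT': "continuous_on A (\<lambda>x. T (h x))" if "continuous_on A h" for A and h :: "'a \<Rightarrow> 'a"
    using continuous_on_compose2[OF cT that] by auto
  have cS: "continuous_on A (\<lambda>x. c *\<^sub>C (h x))" if "continuous_on A h" for A c and h :: "'a \<Rightarrow> 'c::complex_inner"
    using continuous_on_compose2[OF bounded_clinear_continuous[OF
          bounded_clinear_const_scaleC[OF bounded_clinear_id]] that] by auto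
  have induct: "P x" if "closed {x. P x}" "\<And>s. s \<in> S \<Longrightarrow> P s" for P x
    using closure_minimal[of S "{x. P x}"] that dense by auto
  have add1: "T (s + y) = T s + T y" if "s \<in> S" for s y
    by (rule induct[of "\<lambda>y. T (s + y) = T s + T y"])
      (use that S_add g_add in \<open>auto simp: Tg[symmetric] intro!: closed_Collect_eq continuous_intros cT'\<close>)
  have add: "T (x + y) = T x + T y" for x y
    by (rule induct[of "\<lambda>x. T (x + y) = T x + T y"])
      (auto simp: add1 intro!: closed_Collect_eq continuous_intros cT')
  have scale: "T (c *\<^sub>C x) = c *\<^sub>C T x" for c x
    by (rule induct[of "\<lambda>x. T (c *\<^sub>C x) = c *\<^sub>C T x"])
      (use S_scale g_scale in \<open>auto simp: Tg[symmetric] intro!: closed_Collect_eq cS cT'\<close>)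
  have bound: "norm (T x) \<le> norm x * K" for x
    by (rule induct[of "\<lambda>x. norm (T x) \<le> norm x * K"])
      (use g_bound in \<open>auto simp: Tg[symmetric] mult.commute intro!: closed_Collect_le continuous_intros cT'\<close>)
  show thesis
    by (rule that[of T, OF bounded_clinearI[OF add scale bound] Tg[symmetric]])
qed

subsection \<open>Adjoints\<close>

text \<open>The representing vector is the minimiser of \<open>\<parallel>x\<parallel>\<^sup>2 - 2 f x\<close>: by the parallelogram law every
  minimising sequence is Cauchy, and the first variation at the minimum vanishes.\<close>

lemma riesz_real:
  fixes f :: "'a::chilbert_space \<Rightarrow> real"
  assumes f: "bounded_linear f"
  obtains v where "\<And>u. f u = inner v u"
proof -
  define g where "g x = inner x x - 2 * f x" for x
  obtain K where K: "\<And>x. norm (f x) \<le> norm x * K"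
    using bounded_linear.pos_bounded[OF f] by blast
  have f_add: "f (x + y) = f x + f y" and f_scale: "f (r *\<^sub>R x) = r * f x" for x y r
    using linear_add[OF bounded_linear.linear[OF f]] linear_scale[OF bounded_linear.linear[OF f]]
    by simp_all
  have lower: "g x \<ge> - K\<^sup>2" for x
  proof -
    have "f x \<le> norm x * K" using K[of x] by simp
    moreover have "0 \<le> (norm x - K)\<^sup>2" by simp
    ultimately show ?thesis
      by (simp add: g_def power2_norm_eq_inner[symmetric] power2_diff)
  qed
  define m where "m = Inf (range g)"
  have bdd: "bdd_below (range g)" using lower by (auto intro!: bdd_belowI[of _ "- K\<^sup>2"])
  have m_le: "m \<le> g x" for x unfolding m_def by (rule cInf_lower[OF _ bdd]) auto
  have "\<forall>k. \<exists>x. g x < m + 1 / real (Suc k)"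
  proof
    fix k
    show "\<exists>x. g x < m + 1 / real (Suc k)"
      using cInf_lessD[of "range g" "m + 1 / real (Suc k)"] by (auto simp: m_def)
  qed
  from choice[OF this] obtain s where s: "\<And>k. g (s k) < m + 1 / real (Suc k)" by blast
  have para: "(norm (x - y))\<^sup>2 \<le> 2 * (g x - m) + 2 * (g y - m)" for x y
  proof -
    have "g ((1/2) *\<^sub>R (x + y)) = inner (x + y) (x + y) / 4 - (f x + f y)"
      unfolding g_def f_scale f_add inner_scaleR_left inner_scaleR_right by (simp add: field_simps)
    then have "2 * g x + 2 * g y - 4 * g ((1/2) *\<^sub>R (x + y)) = (norm (x - y))\<^sup>2"
      unfolding power2_norm_eq_inner g_def inner_diff_left inner_diff_right inner_add_left
        inner_add_right inner_commute[of y x] by (simp add: field_simps)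
    with m_le[of "(1/2) *\<^sub>R (x + y)"] show ?thesis by simp
  qed
  have "Cauchy s"
  proof (rule metric_CauchyI)
    fix \<epsilon> :: real assume "\<epsilon> > 0"
    then obtain N where N: "1 / real (Suc N) < \<epsilon>\<^sup>2 / 4"
      using reals_Archimedean[of "\<epsilon>\<^sup>2 / 4"] by (auto simp: inverse_eq_divide)
    have small: "g (s k) - m < \<epsilon>\<^sup>2 / 4" if "k \<ge> N" for k
    proof -
      have "1 / real (Suc k) \<le> 1 / real (Suc N)" using that by (intro divide_left_mono) auto
      with s[of k] N show ?thesis by linarith
    qed
    have "dist (s k) (s l) < \<epsilon>" if "k \<ge> N" "l \<ge> N" for k l
    proof -
      have "(norm (s k - s l))\<^sup>2 < \<epsilon>\<^sup>2"
        using para[of "s k" "s l"] small[OF that(1)] small[OF that(2)]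
        by (simp only: less_divide_eq_numeral1 distrib_left right_diff_distrib left_diff_distrib)
      then show ?thesis using \<open>\<epsilon> > 0\<close> by (simp add: dist_norm power_less_imp_less_base)
    qed
    then show "\<exists>M. \<forall>m\<ge>M. \<forall>n\<ge>M. dist (s m) (s n) < \<epsilon>" by blast
  qed
  then obtain v where v: "s \<longlonglongrightarrow> v" using Cauchy_convergent convergent_def by blast
  have "(\<lambda>k. g (s k)) \<longlonglongrightarrow> g v"
    unfolding g_def by (intro tendsto_intros v bounded_linear.tendsto[OF f])
  moreover have "(\<lambda>k. m + 1 / real (Suc k)) \<longlonglongrightarrow> m + 0"
    using LIMSEQ_inverse_real_of_nat by (intro tendsto_add tendsto_const) (simp add: inverse_eq_divide)
  ultimately have gv: "g v \<le> m"
    using s LIMSEQ_le[of "\<lambda>k. g (s k)" "g v" "\<lambda>k. m + 1 / real (Suc k)" m]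
    by (simp add: less_imp_le)
  have "f u = inner v u" for u
  proof -
    define d where "d = inner v u - f u"
    define N where "N = inner u u + 1"
    have N: "N > 0" by (simp add: N_def add_nonneg_pos)
    have "g v \<le> g (v + (- d / N) *\<^sub>R u)" using gv m_le order_trans by blast
    also have "g (v + (- d / N) *\<^sub>R u) = g v + (d / N)\<^sup>2 * inner u u - 2 * (d / N) * d"
    proof -
      have "g (v + t *\<^sub>R u) = g v + t\<^sup>2 * inner u u + 2 * t * d" for t
        unfolding g_def d_def f_add f_scale inner_add_left inner_add_right inner_scaleR_left
          inner_scaleR_right inner_commute[of u v] by (simp add: algebra_simps power2_eq_square)
      from this[of "- d / N"] show ?thesis by simp
    qed
    finally have "2 * (d / N) * d \<le> (d / N)\<^sup>2 * (N - 1)" by (simp add: N_def)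
    moreover define t where "t = d / N"
    ultimately have le: "2 * t * d \<le> t\<^sup>2 * (N - 1)" by simp
    have d: "d = t * N" using N by (simp add: t_def)
    have "t\<^sup>2 * (N + 1) \<le> 0"
      using le unfolding d by (simp add: algebra_simps power2_eq_square)
    then have "t\<^sup>2 \<le> 0" using N by (simp add: mult_le_0_iff)
    then have "d = 0" using d by simp
    then show ?thesis by (simp add: d_def)
  qed
  then show thesis by (rule that)
qed

lemma cadjoint_unique:
  assumes "\<And>u v. cinner (A u) v = cinner u (B v)"
  shows "cadjoint A = (B :: 'a::chilbert_space operator)"
  unfolding cadjoint_def
proof (rule the_equality)
  fix B' assume "\<forall>u v. cinner (A u) v = cinner u (B' v)"
  then have "cinner u (B' v) = cinner u (B v)" for u v using assms by simp
  then show "B' = B" using cinner_extI by blast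
qed (use assms in blast)

lemma cadjoint_works:
  fixes A :: "'a::chilbert_space operator"
  assumes A: "bounded_clinear A"
  shows "cinner (A u) v = cinner u (cadjoint A v)"
proof -
  have "\<exists>w. \<forall>u. cinner (A u) v = cinner u w" for v
  proof -
    have "bounded_linear (\<lambda>u. inner (A u) v)"
      using A unfolding bounded_clinear_def
      by (auto intro: bounded_linear_compose[OF bounded_linear_inner_left])
    then obtain w where w: "\<And>u. inner (A u) v = inner w u" using riesz_real by metis
    have re: "Re (cinner (A u) v) = Re (cinner u w)" for u
      using w[of u] by (simp add: inner_eq_Re_cinner[symmetric] inner_commute)
    \<comment> \<open>The real parts at \<open>\<i> u\<close> are the imaginary parts at \<open>u\<close>.\<close>
    have "Im (cinner (A u) v) = Im (cinner u w)" for u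
      using re[of "\<i> *\<^sub>C u"] by (simp add: bounded_clinear_scaleC[OF A] cinner_scaleC_left)
    with re show ?thesis by (intro exI[of _ w]) (auto intro: complex_eqI)
  qed
  then obtain B where "\<And>u v. cinner (A u) v = cinner u (B v)" by metis
  then show ?thesis using cadjoint_unique[of A B] by simp
qed

lemma cadjoint_works_left:
  assumes "bounded_clinear (A :: 'a::chilbert_space operator)"
  shows "cinner (cadjoint A u) v = cinner u (A v)"
  by (metis assms cadjoint_works cinner_commute)

lemma cadjoint_cadjoint:
  assumes "bounded_clinear (A :: 'a::chilbert_space operator)"
  shows "cadjoint (cadjoint A) = A"
  by (rule cadjoint_unique) (rule cadjoint_works_left[OF assms])

lemma cadjoint_comp:
  assumes "bounded_clinear (A :: 'a::chilbert_space operator)" "bounded_clinear B"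
  shows "cadjoint (A \<circ> B) = cadjoint B \<circ> cadjoint A"
  by (rule cadjoint_unique) (simp add: cadjoint_works assms)


section \<open>The trace of a finite-rank operator\<close>

text \<open>Gram-Schmidt: a new vector enlarges the orthonormal system by its normalised residue, unless that
  residue vanishes.\<close>

lemma orthonormal_frame:
  fixes B :: "'a::complex_inner set"
  assumes "finite B"
  shows "\<exists>U. finite U \<and> card U \<le> card B \<and>
    (\<forall>u\<in>U. \<forall>v\<in>U. cinner u v = (if u = v then 1 else 0)) \<and>
    (\<forall>b\<in>B. b = (\<Sum>u\<in>U. cinner u b *\<^sub>C u))"
  using assms
proof induction
  case (insert b B)
  then obtain U where U: "finite U" "card U \<le> card B"
    "\<And>u v. u \<in> U \<Longrightarrow> v \<in> U \<Longrightarrow> cinner u v = (if u = v then 1 else 0)"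
    "\<And>b. b \<in> B \<Longrightarrow> b = (\<Sum>u\<in>U. cinner u b *\<^sub>C u)" by blast
  define r where "r = b - (\<Sum>u\<in>U. cinner u b *\<^sub>C u)"
  have orth: "cinner u r = 0" if "u \<in> U" for u
  proof -
    have "(\<Sum>v\<in>U. cinner v b * cinner u v) = (\<Sum>v\<in>U. if u = v then cinner u b else 0)"
      using that U(3) by (intro sum.cong) auto
    also have "\<dots> = cinner u b" using that U(1) by simp
    finally show ?thesis by (simp add: r_def cinner_diff_right cinner_sum_right cinner_scaleC_right)
  qed
  show ?case
  proof (cases "r = 0")
    case True
    with U insert.hyps show ?thesis by (intro exI[of _ U]) (auto simp: r_def)
  next
    case False
    define w where "w = (1 / norm r) *\<^sub>R r"
    have ww: "cinner w w = 1" using False by (simp add: w_def cinner_self)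
    have uw: "cinner u w = 0" "cinner w u = 0" if "u \<in> U" for u
      using orth[OF that] cinner_commute[of w u] by (auto simp: w_def cinner_scaleR_right)
    have wU: "w \<notin> U" using uw ww by force
    have rb: "cinner r b = (norm r)\<^sup>2"
    proof -
      have "b = r + (\<Sum>u\<in>U. cinner u b *\<^sub>C u)" by (simp add: r_def)
      then have "cinner r b = cinner r r + (\<Sum>u\<in>U. cinner u b * cinner r u)"
        by (metis (no_types, lifting) cinner_add_right cinner_scaleC_right cinner_sum_right sum.cong)
      also have "(\<Sum>u\<in>U. cinner u b * cinner r u) = 0"
        using orth by (intro sum.neutral) (metis cinner_commute complex_cnj_zero mult_zero_right)
      finally show ?thesis by (simp add: cinner_self)
    qed
    have "cinner w b = complex_of_real (norm r)"
      using False by (simp add: w_def cinner_scaleR_left rb power2_eq_square)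
    then have "cinner w b *\<^sub>C w = r"
      using False by (simp add: scaleR_eq_scaleC[symmetric] w_def)
    then have "b = (\<Sum>u\<in>insert w U. cinner u b *\<^sub>C u)"
      using U(1) wU by (simp add: r_def)
    moreover have "b' = (\<Sum>u\<in>insert w U. cinner u b' *\<^sub>C u)" if "b' \<in> B" for b'
    proof -
      have "cinner w b' = cinner w (\<Sum>u\<in>U. cinner u b' *\<^sub>C u)" using U(4)[OF that] by simp
      also have "\<dots> = 0" by (simp add: cinner_sum_right cinner_scaleC_right uw)
      finally show ?thesis using U(1) U(4)[OF that] wU by simp
    qed
    ultimately show ?thesis
      using U insert.hyps ww uw wU by (intro exI[of _ "insert w U"]) auto
  qed
qed (auto intro!: exI[of _ "{}"])

text \<open>The left-hand side is the trace of an operator whose rank is at most the number of summands: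
  computed in an orthonormal basis of the span of the \<open>\<beta> i\<close>, it is a sum of at most that many
  diagonal entries.\<close>

lemma finite_rank_trace_bound:
  fixes \<beta> \<gamma> :: "'i \<Rightarrow> 'a::complex_inner"
  assumes I: "finite I" and K: "0 \<le> K"
    and bound: "\<And>v. norm (\<Sum>i\<in>I. cinner (\<beta> i) v *\<^sub>C \<gamma> i) \<le> K * norm v"
  shows "cmod (\<Sum>i\<in>I. cinner (\<beta> i) (\<gamma> i)) \<le> of_nat (card I) * K"
proof -
  obtain U where U: "finite U" "card U \<le> card (\<beta> ` I)"
    "\<And>u v. u \<in> U \<Longrightarrow> v \<in> U \<Longrightarrow> cinner u v = (if u = v then 1 else 0)"
    "\<And>i. i \<in> I \<Longrightarrow> \<beta> i = (\<Sum>u\<in>U. cinner u (\<beta> i) *\<^sub>C u)"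
    using orthonormal_frame[of "\<beta> ` I"] I by blast
  let ?X = "\<lambda>v. \<Sum>i\<in>I. cinner (\<beta> i) v *\<^sub>C \<gamma> i"
  have "(\<Sum>i\<in>I. cinner (\<beta> i) (\<gamma> i)) = (\<Sum>i\<in>I. \<Sum>u\<in>U. cinner (\<beta> i) u * cinner u (\<gamma> i))"
  proof (rule sum.cong)
    fix i assume "i \<in> I"
    have "cinner (\<beta> i) (\<gamma> i) = cinner (\<Sum>u\<in>U. cinner u (\<beta> i) *\<^sub>C u) (\<gamma> i)"
      using U(4)[OF \<open>i \<in> I\<close>] by simp
    also have "\<dots> = (\<Sum>u\<in>U. cinner (\<beta> i) u * cinner u (\<gamma> i))"
      unfolding cinner_sum_left cinner_scaleC_left cinner_commute[of "\<beta> i", symmetric] by simp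
    finally show "cinner (\<beta> i) (\<gamma> i) = \<dots>" .
  qed simp
  also have "\<dots> = (\<Sum>u\<in>U. cinner u (?X u))"
    by (subst sum.swap) (simp add: cinner_sum_right cinner_scaleC_right)
  also have "cmod \<dots> \<le> (\<Sum>u\<in>U. K)"
  proof (rule sum_norm_le)
    fix u assume u: "u \<in> U"
    then have "norm u = 1"
      using U(3)[of u u] by (simp add: cinner_self of_real_eq_1_iff power2_eq_1_iff del: of_real_power)
        (metis abs_norm_cancel abs_1 abs_minus_cancel)
    then show "cmod (cinner u (?X u)) \<le> K"
      using cinner_Cauchy_Schwarz[of u "?X u"] bound[of u] by simp
  qed
  also have "\<dots> \<le> of_nat (card I) * K"
    using U(2) card_image_le[OF I, of \<beta>] K by (simp add: mult_right_mono)
  finally show ?thesis .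
qed


section \<open>Projections onto kernels\<close>

lemma powers_selfadjoint:
  assumes "\<And>u v. inner (b u) v = inner u (b v)"
  shows "inner ((b ^^ k) u) v = inner u ((b ^^ k) v)"
  by (induction k arbitrary: u v) (simp_all add: assms funpow_swap1)

text \<open>For a self-adjoint contraction \<open>b\<close> the numbers \<open>t k = \<parallel>b\<^sup>k v\<parallel>\<^sup>2\<close> decrease, and the distance between two
  even powers applied to \<open>v\<close> is controlled by the increments of \<open>t\<close>.\<close>

lemma even_powers_of_contraction_converge:
  fixes b :: "'a::chilbert_space operator"
  assumes sa: "\<And>u v. inner (b u) v = inner u (b v)" and contr: "\<And>v. norm (b v) \<le> norm v"
  shows "convergent (\<lambda>n. (b ^^ (2 * n)) v)"
proof -
  define t where "t k = (norm ((b ^^ k) v))\<^sup>2" for k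
  have "decseq t"
    by (rule decseq_SucI) (simp add: t_def contr power_mono)
  moreover have "bounded (range t)"
  proof -
    have "norm (t k) \<le> t 0" for k using decseqD[OF \<open>decseq t\<close>, of 0 k] by (simp add: t_def)
    then show ?thesis unfolding bounded_iff by blast
  qed
  ultimately have "convergent t"
    using Bseq_monoseq_convergent Bseq_eq_bounded decseq_imp_monoseq by blast
  then obtain L where L: "t \<longlonglongrightarrow> L" by (auto simp: convergent_def)
  have tL: "L \<le> t k" for k by (rule decseq_ge[OF \<open>decseq t\<close> L])
  have split: "(norm ((b ^^ (2 * k)) v - (b ^^ (2 * l)) v))\<^sup>2 = t (2 * k) + t (2 * l) - 2 * t (k + l)" for k l
  proof -
    have "inner ((b ^^ (2 * k)) v) ((b ^^ (2 * l)) v) = inner v ((b ^^ (2 * k + 2 * l)) v)"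
      by (simp add: powers_selfadjoint[OF sa] funpow_add)
    also have "2 * k + 2 * l = (k + l) + (k + l)" by simp
    also have "inner v ((b ^^ ((k + l) + (k + l))) v) = inner ((b ^^ (k + l)) v) ((b ^^ (k + l)) v)"
      unfolding funpow_add[of "k + l" "k + l"] by (simp add: powers_selfadjoint[OF sa])
    finally show ?thesis
      by (simp add: t_def power2_norm_eq_inner inner_diff inner_commute)
  qed
  have "Cauchy (\<lambda>n. (b ^^ (2 * n)) v)"
  proof (rule metric_CauchyI)
    fix \<epsilon> :: real assume "\<epsilon> > 0"
    then have "eventually (\<lambda>n. t n < L + \<epsilon>\<^sup>2 / 2) sequentially"
      using L by (intro order_tendstoD) auto
    then obtain N where N: "t N < L + \<epsilon>\<^sup>2 / 2" by (auto simp: eventually_sequentially)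
    have "dist ((b ^^ (2 * k)) v) ((b ^^ (2 * l)) v) < \<epsilon>" if "k \<ge> N" "l \<ge> N" for k l
    proof -
      have "t (2 * k) \<le> t N" "t (2 * l) \<le> t N"
        using that by (auto intro!: decseqD[OF \<open>decseq t\<close>])
      then have "t (2 * k) + t (2 * l) - 2 * t (k + l) < \<epsilon>\<^sup>2" using N tL[of "k + l"] by argo
      then have "(norm ((b ^^ (2 * k)) v - (b ^^ (2 * l)) v))\<^sup>2 < \<epsilon>\<^sup>2" by (simp only: split)
      then show ?thesis using \<open>\<epsilon> > 0\<close> by (simp add: dist_norm power_less_imp_less_base)
    qed
    then show "\<exists>M. \<forall>m\<ge>M. \<forall>n\<ge>M. dist ((b ^^ (2 * m)) v) ((b ^^ (2 * n)) v) < \<epsilon>" by blast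
  qed
  then show ?thesis by (rule Cauchy_convergent)
qed

text \<open>When \<open>\<parallel>A\<parallel> \<le> K\<close>, the operator \<open>1 - A\<^sup>* A / K\<^sup>2\<close> is a positive contraction that fixes exactly the kernel of
  \<open>A\<close>, so that its powers decrease to the projection onto the kernel.\<close>

definition damping :: "'a::chilbert_space operator \<Rightarrow> real \<Rightarrow> 'a operator" where
  "damping A K = (\<lambda>v. v - (1 / K\<^sup>2) *\<^sub>R cadjoint A (A v))"

definition kernel_projection :: "'a::chilbert_space operator \<Rightarrow> real \<Rightarrow> 'a operator" where
  "kernel_projection A K v = lim (\<lambda>n. (damping A K ^^ (2 * n)) v)"

context
  fixes A :: "'a::chilbert_space operator" and K :: real
  assumes A: "bounded_clinear A" and A': "bounded_clinear (cadjoint A)"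
    and K: "K > 0" and bound: "\<And>v. norm (A v) \<le> K * norm v"
begin

lemma cadjoint_bound: "norm (cadjoint A v) \<le> K * norm v"
proof -
  have "complex_of_real ((norm (cadjoint A v))\<^sup>2) = cinner v (A (cadjoint A v))"
    by (simp add: cinner_self[symmetric] cadjoint_works_left[OF A] del: of_real_power)
  then have "(norm (cadjoint A v))\<^sup>2 = cmod (cinner v (A (cadjoint A v)))"
    by (metis norm_of_real abs_power2)
  also have "\<dots> \<le> norm v * norm (A (cadjoint A v))" by (rule cinner_Cauchy_Schwarz)
  also have "\<dots> \<le> norm v * (K * norm (cadjoint A v))" by (intro mult_left_mono bound) auto
  finally have "norm (cadjoint A v) * norm (cadjoint A v) \<le> (K * norm v) * norm (cadjoint A v)"
    by (simp add: power2_eq_square ac_simps)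
  then show ?thesis
    using K by (cases "norm (cadjoint A v) = 0") (auto simp: mult_le_cancel_right)
qed

lemma bounded_clinear_damping: "bounded_clinear (damping A K)"
proof -
  have "bounded_clinear (\<lambda>v. id v + (- complex_of_real (1 / K\<^sup>2)) *\<^sub>C (cadjoint A \<circ> A) v)"
    by (intro bounded_clinear_plus bounded_clinear_const_scaleC bounded_clinear_id bounded_clinear_comp A A')
  then show ?thesis
    by (simp add: damping_def scaleR_eq_scaleC scaleC_minus_left o_def)
qed

lemma cinner_damping: "cinner (damping A K u) v = cinner u (damping A K v)"
  by (simp add: damping_def cinner_diff_left cinner_diff_right cinner_scaleR_left cinner_scaleR_right
      cadjoint_works[OF A] cadjoint_works_left[OF A])

lemma inner_damping: "inner (damping A K u) v = inner u (damping A K v)"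
  by (simp add: inner_eq_Re_cinner cinner_damping)

lemma norm_damping: "(norm (damping A K v))\<^sup>2 \<le> (norm v)\<^sup>2 - (norm (A v))\<^sup>2 / K\<^sup>2"
proof -
  have 1: "inner v (cadjoint A (A v)) = (norm (A v))\<^sup>2"
    by (simp add: inner_eq_Re_cinner cadjoint_works[OF A, symmetric] cinner_self del: of_real_power)
  have "(norm (cadjoint A (A v)))\<^sup>2 \<le> (K * norm (A v))\<^sup>2"
    by (intro power_mono cadjoint_bound) auto
  then have 2: "(norm (cadjoint A (A v)))\<^sup>2 / K ^ 4 \<le> (norm (A v))\<^sup>2 / K\<^sup>2"
    using K by (simp add: field_simps power2_eq_square power4_eq_xxxx)
  have "(norm (damping A K v))\<^sup>2 =
      inner (v - (1 / K\<^sup>2) *\<^sub>R cadjoint A (A v)) (v - (1 / K\<^sup>2) *\<^sub>R cadjoint A (A v))"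
    by (simp add: power2_norm_eq_inner damping_def)
  also have "\<dots> = (norm v)\<^sup>2 - 2 * (norm (A v))\<^sup>2 / K\<^sup>2 + (norm (cadjoint A (A v)))\<^sup>2 / K ^ 4"
    unfolding inner_diff_left inner_diff_right
      inner_scaleR_left inner_scaleR_right inner_commute[of "cadjoint A (A v)" v] 1
      power2_norm_eq_inner[symmetric, of v] power2_norm_eq_inner[symmetric, of "cadjoint A (A v)"]
    using K by (simp add: field_simps power2_eq_square power4_eq_xxxx)
  finally show ?thesis using 2 by linarith
qed

lemma damping_contraction: "norm (damping A K v) \<le> norm v"
proof -
  have "0 \<le> (norm (A v))\<^sup>2 / K\<^sup>2" by simp
  with norm_damping[of v] have "(norm (damping A K v))\<^sup>2 \<le> (norm v)\<^sup>2" by linarith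
  then show ?thesis by (simp add: power2_le_iff_abs_le)
qed

lemma kernel_projection_tendsto:
  "(\<lambda>n. (damping A K ^^ (2 * n)) v) \<longlonglongrightarrow> kernel_projection A K v"
  unfolding kernel_projection_def convergent_LIMSEQ_iff[symmetric]
  by (rule even_powers_of_contraction_converge) (simp_all add: inner_damping damping_contraction)

lemma bounded_clinear_damping_power: "bounded_clinear (damping A K ^^ k)"
  by (induction k) (simp_all only: funpow.simps bounded_clinear_id bounded_clinear_comp bounded_clinear_damping)

lemma kernel_projection_eqI: "(\<lambda>n. (damping A K ^^ (2 * n)) v) \<longlonglongrightarrow> w \<Longrightarrow> kernel_projection A K v = w"
  by (rule LIMSEQ_unique[OF kernel_projection_tendsto])

lemma bounded_clinear_kernel_projection: "bounded_clinear (kernel_projection A K)"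
proof (rule bounded_clinearI[where K=1])
  fix x y c
  show "kernel_projection A K (x + y) = kernel_projection A K x + kernel_projection A K y"
    by (rule kernel_projection_eqI)
      (simp add: bounded_clinear_add[OF bounded_clinear_damping_power] tendsto_add kernel_projection_tendsto)
  show "kernel_projection A K (c *\<^sub>C x) = c *\<^sub>C kernel_projection A K x"
    by (rule kernel_projection_eqI)
      (simp add: bounded_clinear_scaleC[OF bounded_clinear_damping_power] kernel_projection_tendsto
        bounded_clinear_tendsto[OF bounded_clinear_const_scaleC[OF bounded_clinear_id], simplified])
  have "norm ((damping A K ^^ k) x) \<le> norm x" for k
    by (induction k) (auto intro: order_trans[OF damping_contraction])
  then show "norm (kernel_projection A K x) \<le> norm x * 1"
    using LIMSEQ_le_const2[OF tendsto_norm[OF kernel_projection_tendsto]] by auto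
qed

lemma kernel_projection_selfadjoint:
  "cinner (kernel_projection A K u) v = cinner u (kernel_projection A K v)"
proof (rule LIMSEQ_unique)
  have "cinner ((damping A K ^^ k) u) v = cinner u ((damping A K ^^ k) v)" for k
    by (induction k arbitrary: u v) (simp_all add: cinner_damping funpow_swap1)
  then show "(\<lambda>n. cinner ((damping A K ^^ (2 * n)) u) v) \<longlonglongrightarrow> cinner u (kernel_projection A K v)"
    by (simp add: tendsto_cinner[OF tendsto_const kernel_projection_tendsto])
qed (rule tendsto_cinner[OF kernel_projection_tendsto tendsto_const])

lemma apply_kernel_projection: "A (kernel_projection A K v) = 0"
proof -
  define w where "w = kernel_projection A K v"
  have "(\<lambda>n. damping A K (damping A K ((damping A K ^^ (2 * n)) v))) \<longlonglongrightarrow> damping A K (damping A K w)"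
    unfolding w_def by (intro bounded_clinear_tendsto[OF bounded_clinear_damping] kernel_projection_tendsto)
  moreover have "(\<lambda>n. (damping A K ^^ (2 * Suc n)) v) \<longlonglongrightarrow> w"
    using LIMSEQ_Suc[OF kernel_projection_tendsto] by (simp add: w_def)
  ultimately have "damping A K (damping A K w) = w" by (auto dest: LIMSEQ_unique)
  then have "norm w \<le> norm (damping A K w)" by (metis damping_contraction)
  then have "(norm w)\<^sup>2 \<le> (norm (damping A K w))\<^sup>2" by (simp add: power_mono)
  with norm_damping[of w] have "(norm (A w))\<^sup>2 / K\<^sup>2 \<le> 0" by linarith
  then show ?thesis using K by (simp add: w_def field_simps)
qed

lemma kernel_projection_fix:
  assumes "A v = 0" shows "kernel_projection A K v = v"
proof (rule kernel_projection_eqI)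
  have "(damping A K ^^ k) v = v" for k
    by (induction k) (use assms in \<open>simp_all add: damping_def bounded_clinear_zero[OF A']\<close>)
  then show "(\<lambda>n. (damping A K ^^ (2 * n)) v) \<longlonglongrightarrow> v" by simp
qed

lemma kernel_projection_comp_cadjoint: "kernel_projection A K (cadjoint A v) = 0"
proof (rule cinner_eq_zeroI)
  fix u
  have "cinner u (kernel_projection A K (cadjoint A v)) = cinner (A (kernel_projection A K u)) v"
    by (simp add: kernel_projection_selfadjoint[symmetric] cadjoint_works[OF A])
  then show "cinner u (kernel_projection A K (cadjoint A v)) = 0"
    by (simp add: apply_kernel_projection)
qed

lemma kernel_projection_commute:
  assumes T: "bounded_clinear T" "\<And>v. T (A v) = A (T v)" "\<And>v. T (cadjoint A v) = cadjoint A (T v)"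
  shows "kernel_projection A K (T v) = T (kernel_projection A K v)"
proof (rule kernel_projection_eqI)
  have "(damping A K ^^ k) (T v) = T ((damping A K ^^ k) v)" for k
    by (induction k) (simp_all add: damping_def T bounded_clinear_diff bounded_clinear_scaleR)
  then show "(\<lambda>n. (damping A K ^^ (2 * n)) (T v)) \<longlonglongrightarrow> T (kernel_projection A K v)"
    by (simp add: bounded_clinear_tendsto[OF T(1)] kernel_projection_tendsto)
qed

end


section \<open>Tracial algebras of operators\<close>

text \<open>An abstraction of the left multiplications on \<open>L\<^sup>2\<close> of a tracial von Neumann algebra, with \<open>e\<close> the
  vector \<open>1\<close>. In that example right multiplications lie in the commutant, and the one by \<open>B\<close> sends \<open>1\<close> to
  \<open>B\<close>: this gives the last two properties.\<close>

locale tracial_algebra =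
  fixes \<A> :: "'h::chilbert_space operator set" and e :: 'h
  assumes bounded: "A \<in> \<A> \<Longrightarrow> bounded_clinear A"
    and id_mem: "id \<in> \<A>"
    and add_mem: "A \<in> \<A> \<Longrightarrow> B \<in> \<A> \<Longrightarrow> (\<lambda>v. A v + B v) \<in> \<A>"
    and scaleC_mem: "A \<in> \<A> \<Longrightarrow> (\<lambda>v. c *\<^sub>C A v) \<in> \<A>"
    and comp_mem: "A \<in> \<A> \<Longrightarrow> B \<in> \<A> \<Longrightarrow> A \<circ> B \<in> \<A>"
    and cadjoint_mem: "A \<in> \<A> \<Longrightarrow> cadjoint A \<in> \<A>"
    and trace: "A \<in> \<A> \<Longrightarrow> B \<in> \<A> \<Longrightarrow> cinner e (A (B e)) = cinner e (B (A e))"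
    and norm_e: "norm e = 1"
    and commutant_dense: "closure {T e |T. T \<in> commutant \<A>} = UNIV"
    and commutant_vector: "A \<in> \<A> \<Longrightarrow> \<exists>T\<in>commutant \<A>. T e = A e"
begin

lemma commutantD:
  "T \<in> commutant \<A> \<Longrightarrow> A \<in> \<A> \<Longrightarrow> T (A v) = A (T v)"
  "T \<in> commutant \<A> \<Longrightarrow> bounded_clinear T"
  unfolding commutant_def by (blast intro: comp_eq_dest) simp

lemma mem_bicommutant: "A \<in> \<A> \<Longrightarrow> A \<in> commutant (commutant \<A>)"
  by (simp add: commutant_def[of "commutant \<A>"] bounded) (auto simp: commutant_def)

lemma comp_bicommutant:
  "A \<in> commutant (commutant \<A>) \<Longrightarrow> B \<in> commutant (commutant \<A>) \<Longrightarrow> A \<circ> B \<in> commutant (commutant \<A>)"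
  unfolding commutant_def[of "commutant \<A>"] mem_Collect_eq
  by (metis bounded_clinear_comp comp_assoc)

lemma separating_vector:
  assumes S: "S \<in> commutant (commutant \<A>)" and "S e = 0"
  shows "S v = 0"
proof -
  have bS: "bounded_clinear S" using S by (simp add: commutant_def)
  have "S (T e) = 0" if T: "T \<in> commutant \<A>" for T
  proof -
    have "S \<circ> T = T \<circ> S" using S T unfolding commutant_def[of "commutant \<A>"] by blast
    then have "S (T e) = T (S e)" by (metis comp_apply)
    then show ?thesis using \<open>S e = 0\<close> bounded_clinear_zero[OF commutantD(2)[OF T]] by simp
  qed
  then have "S = (\<lambda>v. 0)"
    by (intro bounded_clinear_eq_on_dense[OF bS _ commutant_dense])
      (auto intro: bounded_clinearI[where K=0])
  then show ?thesis by simp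
qed

lemma scaleR_mem: "A \<in> \<A> \<Longrightarrow> (\<lambda>v. r *\<^sub>R A v) \<in> \<A>"
  by (simp add: scaleR_eq_scaleC scaleC_mem)

lemma zero_mem: "(\<lambda>v. 0) \<in> \<A>"
  using scaleC_mem[OF id_mem, of 0] by simp

lemma diff_mem: "A \<in> \<A> \<Longrightarrow> B \<in> \<A> \<Longrightarrow> (\<lambda>v. A v - B v) \<in> \<A>"
  using add_mem[of A "\<lambda>v. (-1) *\<^sub>C B v"] scaleC_mem[of B "-1"] by (simp add: scaleC_minus_left)

lemma sum_mem: "(\<And>i. i \<in> I \<Longrightarrow> A i \<in> \<A>) \<Longrightarrow> (\<lambda>v. \<Sum>i\<in>I. A i v) \<in> \<A>"
  by (induction I rule: infinite_finite_induct) (auto simp: zero_mem add_mem)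

lemma funpow_mem: "A \<in> \<A> \<Longrightarrow> A ^^ k \<in> \<A>"
  by (induction k) (simp_all only: funpow.simps id_mem comp_mem)

lemma damping_mem: "A \<in> \<A> \<Longrightarrow> damping A K \<in> \<A>"
  using diff_mem[OF id_mem scaleR_mem[OF comp_mem[OF cadjoint_mem]]]
  by (simp add: damping_def o_def)

text \<open>\<open>A\<close> intertwines \<open>1 - A\<^sup>*A/K\<^sup>2\<close> and \<open>1 - AA\<^sup>*/K\<^sup>2\<close>, so that the trace property gives equal moments.\<close>

lemma trace_damping_cadjoint:
  assumes A: "A \<in> \<A>"
  shows "cinner e ((damping A K ^^ k) e) = cinner e ((damping (cadjoint A) K ^^ k) e)"
proof (induction k)
  case (Suc k)
  let ?b = "damping A K" and ?c = "damping (cadjoint A) K"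
  have A': "cadjoint A \<in> \<A>" and bA: "bounded_clinear A" using A by (auto simp: cadjoint_mem bounded)
  have AA: "cadjoint (cadjoint A) = A" by (rule cadjoint_cadjoint[OF bA])
  have bb: "bounded_clinear (?b ^^ k)" and bc: "bounded_clinear (?c ^^ k)"
    using A A' by (auto intro: bounded funpow_mem damping_mem)
  have "A (?b v) = ?c (A v)" for v
    by (simp add: damping_def AA bounded_clinear_diff[OF bA] bounded_clinear_scaleR[OF bA])
  then have inter: "A ((?b ^^ k) v) = (?c ^^ k) (A v)" for v by (induction k) auto
  have "cinner e ((?b ^^ k) (cadjoint A (A e))) = cinner e (((?b ^^ k) \<circ> cadjoint A) (A e))" by simp
  also have "\<dots> = cinner e (A (((?b ^^ k) \<circ> cadjoint A) e))"
    by (intro trace comp_mem funpow_mem damping_mem A A')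
  also have "\<dots> = cinner e ((?c ^^ k) (A (cadjoint A e)))" by (simp add: inter)
  finally have mixed: "cinner e ((?b ^^ k) (cadjoint A (A e))) = \<dots>" .
  have be: "?b e = e - (1 / K\<^sup>2) *\<^sub>R cadjoint A (A e)" and ce: "?c e = e - (1 / K\<^sup>2) *\<^sub>R A (cadjoint A e)"
    by (simp_all add: damping_def AA)
  have "cinner e ((?b ^^ Suc k) e)
      = cinner e ((?b ^^ k) e) - of_real (1 / K\<^sup>2) * cinner e ((?b ^^ k) (cadjoint A (A e)))"
    unfolding funpow_Suc_right comp_apply be bounded_clinear_diff[OF bb] bounded_clinear_scaleR[OF bb]
      cinner_diff_right cinner_scaleR_right ..
  also have "\<dots> = cinner e ((?c ^^ Suc k) e)"
    unfolding mixed Suc.IH funpow_Suc_right comp_apply ce bounded_clinear_diff[OF bc]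
      bounded_clinear_scaleR[OF bc] cinner_diff_right cinner_scaleR_right ..
  finally show ?case .
qed simp

lemma kernel_projection_bicommutant:
  assumes A: "A \<in> \<A>" and K: "K > 0" "\<And>v. norm (A v) \<le> K * norm v"
  shows "kernel_projection A K \<in> commutant (commutant \<A>)"
proof -
  note ctx = bounded[OF A] bounded[OF cadjoint_mem[OF A]] K
  have "kernel_projection A K (T v) = T (kernel_projection A K v)" if "T \<in> commutant \<A>" for T v
    using that A by (intro kernel_projection_commute[OF ctx]) (auto simp: commutantD cadjoint_mem)
  then show ?thesis
    using bounded_clinear_kernel_projection[OF ctx] unfolding commutant_def[of "commutant \<A>"] comp_def
    by simp
qed

text \<open>In a tracial algebra the kernels of \<open>A\<close> and \<open>A\<^sup>*\<close> have projections of equal trace, and the trace of a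
  projection that commutes with the commutant vanishes only for the zero projection.\<close>

lemma kernel_cadjoint_nontrivial:
  assumes A: "A \<in> \<A>" and v: "A v = 0" "v \<noteq> 0"
  obtains w where "cadjoint A w = 0" "w \<noteq> 0"
proof -
  obtain K where K: "K > 0" "\<And>v. norm (A v) \<le> K * norm v"
    using bounded_clinear_bound[OF bounded[OF A]] by metis
  note A' = cadjoint_mem[OF A]
  note ctx = bounded[OF A] bounded[OF A'] K
  have AA: "cadjoint (cadjoint A) = A" by (rule cadjoint_cadjoint[OF bounded[OF A]])
  have ctx': "bounded_clinear (cadjoint A)" "bounded_clinear (cadjoint (cadjoint A))"
    "0 < K" "\<And>v. norm (cadjoint A v) \<le> K * norm v"
    using bounded[OF A'] bounded[OF A] cadjoint_bound[OF ctx] K(1) unfolding AA by simp_all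
  let ?E = "kernel_projection A K" and ?F = "kernel_projection (cadjoint A) K"
  have "cinner e (?E e) = cinner e (?F e)"
  proof (rule LIMSEQ_unique)
    show "(\<lambda>n. cinner e ((damping A K ^^ (2 * n)) e)) \<longlonglongrightarrow> cinner e (?E e)"
      by (intro tendsto_cinner tendsto_const kernel_projection_tendsto[OF ctx])
    show "(\<lambda>n. cinner e ((damping A K ^^ (2 * n)) e)) \<longlonglongrightarrow> cinner e (?F e)"
      unfolding trace_damping_cadjoint[OF A]
      by (intro tendsto_cinner tendsto_const kernel_projection_tendsto[OF ctx'])
  qed
  moreover have "cinner e (?E e) = (norm (?E e))\<^sup>2"
  proof -
    have "cinner e (?E e) = cinner e (?E (?E e))"
      by (simp only: kernel_projection_fix[OF ctx apply_kernel_projection[OF ctx]])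
    also have "\<dots> = cinner (?E e) (?E e)" by (rule kernel_projection_selfadjoint[OF ctx, symmetric])
    finally show ?thesis by (simp add: cinner_self)
  qed
  moreover have "?E e \<noteq> 0"
    using separating_vector[OF kernel_projection_bicommutant[OF A K], of v] v
      kernel_projection_fix[OF ctx, of v] by auto
  ultimately have "?F e \<noteq> 0" by auto
  then show thesis using that apply_kernel_projection[OF ctx'] by blast
qed

end


section \<open>Dual systems exclude zero divisors\<close>

text \<open>The occurrences of the letter \<open>k\<close> in a word, each recorded by the words before and after it; they index
  the terms of the free difference quotient of a monomial.\<close>

definition splits :: "nat \<Rightarrow> nat list \<Rightarrow> (nat list \<times> nat list) set" where
  "splits k w = {(a, b). a @ k # b = w}"

lemma splits_Nil: "splits k [] = {}"
  by (simp add: splits_def)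

lemma splits_Cons:
  "splits k (j # w) = (if j = k then {([], w)} else {}) \<union> (\<lambda>(a, b). (j # a, b)) ` splits k w"
proof (rule set_eqI, clarify)
  fix a b
  show "((a, b) \<in> splits k (j # w)) =
      ((a, b) \<in> (if j = k then {([], w)} else {}) \<union> (\<lambda>(a, b). (j # a, b)) ` splits k w)"
    by (cases a) (auto simp: splits_def image_iff)
qed

lemma finite_splits: "finite (splits k w)"
  by (induction w) (auto simp: splits_Nil splits_Cons)

lemma sum_splits_Cons:
  "(\<Sum>(a, b)\<in>splits k (j # w). f a b)
    = (if j = k then f [] w else 0) + (\<Sum>(a, b)\<in>splits k w. f (j # a) b :: 'a::comm_monoid_add)"
proof -
  have inj: "inj_on (\<lambda>(a, b). (j # a, b)) (splits k w)" by (auto simp: inj_on_def)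
  have "(\<Sum>(a, b)\<in>splits k (j # w). f a b) = (\<Sum>(a, b)\<in>(if j = k then {([], w)} else {}). f a b)
      + (\<Sum>(a, b)\<in>(\<lambda>(a, b). (j # a, b)) ` splits k w. f a b)"
    unfolding splits_Cons by (rule sum.union_disjoint) (auto simp: finite_splits)
  also have "(\<Sum>(a, b)\<in>(\<lambda>(a, b). (j # a, b)) ` splits k w. f a b) = (\<Sum>(a, b)\<in>splits k w. f (j # a) b)"
    by (subst sum.reindex[OF inj]) (simp add: comp_def case_prod_unfold)
  finally show ?thesis by simp
qed

lemma card_splits: "card (splits k w) = count_list w k"
proof (induction w)
  case (Cons j w)
  then show ?case using sum_splits_Cons[of "\<lambda>_ _. 1 :: nat" k j w] by simp
qed (simp add: splits_Nil)

lemma nc_monomial_Nil: "nc_monomial y [] = id"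
  and nc_monomial_Cons: "nc_monomial y (j # w) = y j \<circ> nc_monomial y w"
  by (simp_all add: nc_monomial_def)

lemma nc_monomial_append: "nc_monomial y (u @ w) = nc_monomial y u \<circ> nc_monomial y w"
  by (induction u) (simp_all add: nc_monomial_Nil nc_monomial_Cons comp_assoc)

definition words :: "nat \<Rightarrow> nat \<Rightarrow> nat list set" where
  "words m d = {w. set w \<subseteq> {1..m} \<and> length w \<le> d}"

lemma finite_words: "finite (words m d)"
  unfolding words_def by (rule finite_lists_length_le) simp

text \<open>Sorting the occurrences of the letter \<open>k\<close> in words by the words on their two sides.\<close>

lemma sum_words_splits:
  fixes f :: "nat list \<Rightarrow> nat list \<Rightarrow> 'a::complex_inner"
  assumes c: "\<And>w. w \<notin> words m (Suc d) \<Longrightarrow> c w = 0"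
  shows "(\<Sum>w\<in>words m (Suc d). c w *\<^sub>C (\<Sum>(a, b)\<in>splits k w. f a b))
    = (\<Sum>a\<in>words m d. \<Sum>b\<in>words m d. c (a @ k # b) *\<^sub>C f a b)"
proof -
  let ?P = "{(a, b). a @ k # b \<in> words m (Suc d)}"
  have "(\<Sum>w\<in>words m (Suc d). c w *\<^sub>C (\<Sum>(a, b)\<in>splits k w. f a b))
      = (\<Sum>w\<in>words m (Suc d). \<Sum>p\<in>splits k w. c w *\<^sub>C f (fst p) (snd p))"
    by (simp add: scaleC_sum_right case_prod_unfold)
  also have "\<dots> = (\<Sum>(w, p)\<in>Sigma (words m (Suc d)) (splits k). c w *\<^sub>C f (fst p) (snd p))"
    by (rule sum.Sigma) (auto simp: finite_words finite_splits)
  also have "\<dots> = (\<Sum>(a, b)\<in>?P. c (a @ k # b) *\<^sub>C f a b)"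
    by (rule sum.reindex_bij_witness[of _ "\<lambda>(a, b). (a @ k # b, a, b)" snd])
      (auto simp: splits_def)
  also have "\<dots> = (\<Sum>(a, b)\<in>words m d \<times> words m d. c (a @ k # b) *\<^sub>C f a b)"
  proof (rule sum.mono_neutral_left)
    show "\<forall>p\<in>words m d \<times> words m d - ?P. (case p of (a, b) \<Rightarrow> c (a @ k # b) *\<^sub>C f a b) = 0"
    proof
      fix p assume "p \<in> words m d \<times> words m d - ?P"
      then have "fst p @ k # snd p \<notin> words m (Suc d)" by auto
      then show "(case p of (a, b) \<Rightarrow> c (a @ k # b) *\<^sub>C f a b) = 0"
        by (simp add: c case_prod_unfold)
    qed
  qed (auto simp: finite_words, auto simp: words_def)
  also have "\<dots> = (\<Sum>a\<in>words m d. \<Sum>b\<in>words m d. c (a @ k # b) *\<^sub>C f a b)"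
    by (rule sum.cartesian_product[symmetric])
  finally show ?thesis .
qed

locale dual_family = tracial_algebra \<A> e
  for \<A> :: "'h::chilbert_space operator set" and e +
  fixes x R :: "nat \<Rightarrow> 'h operator" and m :: nat
  assumes generator_mem: "j \<in> {1..m} \<Longrightarrow> x j \<in> \<A>"
    and dual: "dual_system x e m R"
begin

lemma bounded_dual: "k \<in> {1..m} \<Longrightarrow> bounded_clinear (R k)"
  using dual by (simp add: dual_system_def)

lemma dual_generator:
  assumes "j \<in> {1..m}" "k \<in> {1..m}"
  shows "R k (x j v) = x j (R k v) + (if j = k then cinner e v *\<^sub>C e else 0)"
proof -
  have "commutator (R k) (x j) v = (if k = j then line_projection e else (\<lambda>v. 0)) v"
    using dual assms by (simp add: dual_system_def)
  then show ?thesis by (auto simp: commutator_def line_projection_def algebra_simps split: if_splits)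
qed

lemma monomial_mem: "set w \<subseteq> {1..m} \<Longrightarrow> nc_monomial x w \<in> \<A>"
  by (induction w) (simp_all only: nc_monomial_Nil nc_monomial_Cons id_mem comp_mem generator_mem
      list.set insert_subset)

lemma dual_monomial:
  assumes "set w \<subseteq> {1..m}" "k \<in> {1..m}"
  shows "R k (nc_monomial x w v) =
    nc_monomial x w (R k v) + (\<Sum>(a, b)\<in>splits k w. cinner e (nc_monomial x b v) *\<^sub>C nc_monomial x a e)"
  using assms(1)
proof (induction w)
  case (Cons j w)
  then have j: "j \<in> {1..m}" by simp
  then have bj: "bounded_clinear (x j)" by (intro bounded generator_mem)
  show ?case
    using Cons j sum_splits_Cons[of "\<lambda>a b. cinner e (nc_monomial x b v) *\<^sub>C nc_monomial x a e" k j w]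
    by (simp add: nc_monomial_Cons nc_monomial_Nil dual_generator[OF j assms(2)]
        bounded_clinear_add[OF bj] bounded_clinear_sum[OF bj] bounded_clinear_scaleC[OF bj]
        case_prod_unfold)
qed (simp add: splits_Nil nc_monomial_Nil)

definition word_sum :: "nat \<Rightarrow> (nat list \<Rightarrow> complex) \<Rightarrow> 'h operator" where
  "word_sum d c = (\<lambda>v. \<Sum>w\<in>words m d. c w *\<^sub>C nc_monomial x w v)"

lemma word_sum_mem: "word_sum d c \<in> \<A>"
  unfolding word_sum_def by (intro sum_mem scaleC_mem monomial_mem) (simp add: words_def)

lemma dual_word_sum:
  assumes c: "\<And>w. w \<notin> words m (Suc d) \<Longrightarrow> c w = 0" and k: "k \<in> {1..m}"
  shows "R k (word_sum (Suc d) c v) - word_sum (Suc d) c (R k v) =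
    (\<Sum>a\<in>words m d. \<Sum>b\<in>words m d. c (a @ k # b) *\<^sub>C cinner e (nc_monomial x b v) *\<^sub>C nc_monomial x a e)"
proof -
  have "R k (word_sum (Suc d) c v) - word_sum (Suc d) c (R k v) =
      (\<Sum>w\<in>words m (Suc d). c w *\<^sub>C (R k (nc_monomial x w v) - nc_monomial x w (R k v)))"
    by (simp add: word_sum_def bounded_clinear_sum[OF bounded_dual[OF k]]
        bounded_clinear_scaleC[OF bounded_dual[OF k]] scaleC_diff_right sum_subtractf)
  also have "\<dots> = (\<Sum>w\<in>words m (Suc d). c w *\<^sub>C
      (\<Sum>(a, b)\<in>splits k w. cinner e (nc_monomial x b v) *\<^sub>C nc_monomial x a e))"
  proof (rule sum.cong)
    fix w assume "w \<in> words m (Suc d)"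
    then have "set w \<subseteq> {1..m}" by (simp add: words_def)
    then show "c w *\<^sub>C (R k (nc_monomial x w v) - nc_monomial x w (R k v)) = c w *\<^sub>C
        (\<Sum>(a, b)\<in>splits k w. cinner e (nc_monomial x b v) *\<^sub>C nc_monomial x a e)"
      by (simp only: dual_monomial[OF _ k] add_diff_cancel_left')
  qed simp
  also have "\<dots> = (\<Sum>a\<in>words m d. \<Sum>b\<in>words m d.
      c (a @ k # b) *\<^sub>C cinner e (nc_monomial x b v) *\<^sub>C nc_monomial x a e)"
    by (rule sum_words_splits[OF c])
  finally show ?thesis .
qed

text \<open>Let \<open>E\<close> and \<open>F\<close> be the projections onto the kernels of \<open>A\<close> and \<open>A\<^sup>*\<close>. Then \<open>F [R\<^sub>k, A] E = 0\<close>.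
  Applied to a vector, \<open>[R\<^sub>k, A] E\<close> gives \<open>G e\<close> for a polynomial \<open>G\<close> of smaller degree; since \<open>e\<close> is
  separating, \<open>F G = 0\<close>, so \<open>G\<^sup>*\<close> and hence \<open>G\<close> have a kernel, and \<open>G = 0\<close> by induction. The constant
  coefficient of \<open>G\<close> is \<open>\<langle>e, H E \<xi>\<rangle>\<close>, where \<open>H\<close> collects the monomials of \<open>A\<close> that start with \<open>k\<close>. As
  this vanishes for all \<open>\<xi>\<close>, \<open>H E = 0\<close>, and induction gives \<open>H = 0\<close>.\<close>

theorem polynomial_kernel_trivial:
  assumes "\<And>w. w \<notin> words m d \<Longrightarrow> c w = 0" and "word_sum d c v = 0" and "v \<noteq> 0"
  shows "c w = 0"
  using assms
proof (induction d arbitrary: c v w)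
  case 0
  have words0: "words m 0 = {[]}" by (auto simp: words_def)
  with 0 have "c [] = 0" by (simp add: word_sum_def nc_monomial_Nil scaleC_eq_0_iff)
  then show ?case using 0(1)[of w] by (cases "w = []") (auto simp: words0)
next
  case (Suc d)
  define A where "A = word_sum (Suc d) c"
  have A: "A \<in> \<A>" unfolding A_def by (rule word_sum_mem)
  note A' = cadjoint_mem[OF A]
  obtain K where K: "K > 0" "\<And>v. norm (A v) \<le> K * norm v"
    using bounded_clinear_bound[OF bounded[OF A]] by metis
  note ctx = bounded[OF A] bounded[OF A'] K
  have AA: "cadjoint (cadjoint A) = A" by (rule cadjoint_cadjoint[OF bounded[OF A]])
  have ctx': "bounded_clinear (cadjoint A)" "bounded_clinear (cadjoint (cadjoint A))"
    "0 < K" "\<And>v. norm (cadjoint A v) \<le> K * norm v"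
    using bounded[OF A'] bounded[OF A] cadjoint_bound[OF ctx] K(1) unfolding AA by simp_all
  define E F where "E = kernel_projection A K" and "F = kernel_projection (cadjoint A) K"
  have E: "E \<in> commutant (commutant \<A>)"
    unfolding E_def by (rule kernel_projection_bicommutant[OF A K])
  have F: "F \<in> commutant (commutant \<A>)" and bF: "bounded_clinear F"
    unfolding F_def by (rule kernel_projection_bicommutant[OF A' ctx'(3,4)])
      (rule bounded_clinear_kernel_projection[OF ctx'])
  have AE: "A (E u) = 0" for u unfolding E_def by (rule apply_kernel_projection[OF ctx])
  have FA: "F (A u) = 0" for u
    using kernel_projection_comp_cadjoint[OF ctx', of u] by (simp add: F_def AA)
  have Ev: "E v = v" unfolding E_def
    by (rule kernel_projection_fix[OF ctx]) (use Suc.prems(2) in \<open>simp add: A_def\<close>)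
  have E_sa: "cinner (E u) w = cinner u (E w)" for u w
    unfolding E_def by (rule kernel_projection_selfadjoint[OF ctx])
  have F_sa: "cinner (F u) w = cinner u (F w)" for u w
    unfolding F_def by (rule kernel_projection_selfadjoint[OF ctx'])
  have Fv: "\<exists>w. F w \<noteq> 0"
  proof -
    obtain w where "cadjoint A w = 0" "w \<noteq> 0"
      using kernel_cadjoint_nontrivial[OF A _ Suc.prems(3)] Suc.prems(2) by (auto simp: A_def)
    then show ?thesis using kernel_projection_fix[OF ctx', of w] by (intro exI[of _ w]) (simp add: F_def)
  qed
  have tail: "c (k # b) = 0" if k: "k \<in> {1..m}" for k b
  proof -
    define H where "H = word_sum d (\<lambda>b. c (k # b))"
    have H: "H \<in> \<A>" unfolding H_def by (rule word_sum_mem)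
    have H_zero: "cinner e (H (E \<xi>)) = 0" for \<xi>
    proof -
      define g where "g a = (\<Sum>b\<in>words m d. c (a @ k # b) * cinner e (nc_monomial x b (E \<xi>)))" for a
      define G where "G = word_sum d g"
      have G: "G \<in> \<A>" unfolding G_def by (rule word_sum_mem)
      have "R k (A (E \<xi>)) - A (R k (E \<xi>)) = (\<Sum>a\<in>words m d. \<Sum>b\<in>words m d.
          c (a @ k # b) *\<^sub>C cinner e (nc_monomial x b (E \<xi>)) *\<^sub>C nc_monomial x a e)"
        unfolding A_def by (rule dual_word_sum[OF _ k]) (rule Suc.prems(1))
      also have "\<dots> = G e"
        unfolding G_def word_sum_def g_def by (simp add: scaleC_scaleC scaleC_sum_left)
      finally have "R k (A (E \<xi>)) - A (R k (E \<xi>)) = G e" .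
      then have "F (- A (R k (E \<xi>))) = F (G e)"
        by (simp add: AE bounded_clinear_zero[OF bounded_dual[OF k]])
      then have "(F \<circ> G) e = 0" by (simp add: bounded_clinear_minus[OF bF] FA)
      then have FG: "F (G u) = 0" for u
        using separating_vector[OF comp_bicommutant[OF F mem_bicommutant[OF G]]] by simp
      obtain w0 where w0: "F w0 \<noteq> 0" using Fv by blast
      have "cadjoint G (F w0) = 0"
        by (rule cinner_eq_zeroI)
          (simp add: cadjoint_works[OF bounded[OF G], symmetric] F_sa[symmetric] FG)
      then obtain u where u: "G u = 0" "u \<noteq> 0"
        using kernel_cadjoint_nontrivial[OF cadjoint_mem[OF G] _ w0]
          cadjoint_cadjoint[OF bounded[OF G]] by metis
      have "g [] = 0"
      proof (rule Suc.IH[of g u])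
        show "g a = 0" if "a \<notin> words m d" for a
        proof -
          have "a @ k # b \<notin> words m (Suc d)" for b using that by (fastforce simp: words_def)
          then show ?thesis unfolding g_def by (simp add: Suc.prems(1))
        qed
      qed (use u in \<open>simp_all add: G_def\<close>)
      then show ?thesis
        by (simp add: g_def H_def word_sum_def cinner_sum_right cinner_scaleC_right)
    qed
    have H': "cadjoint H \<in> \<A>" by (rule cadjoint_mem[OF H])
    have "(E \<circ> cadjoint H) e = 0"
    proof (rule cinner_eq_zeroI)
      fix \<xi>
      have "cinner \<xi> (E (cadjoint H e)) = cinner (H (E \<xi>)) e"
        by (simp add: E_sa[symmetric] cadjoint_works[OF bounded[OF H]])
      also have "\<dots> = 0" using H_zero[of \<xi>] by (metis cinner_commute complex_cnj_zero)
      finally show "cinner \<xi> ((E \<circ> cadjoint H) e) = 0" by simp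
    qed
    then have EH: "E (cadjoint H u) = 0" for u
      using separating_vector[OF comp_bicommutant[OF E mem_bicommutant[OF H']]] by simp
    have "H (E v) = 0"
      by (rule cinner_eq_zeroI)
        (simp add: cadjoint_works_left[OF bounded[OF H], symmetric] E_sa[symmetric] EH)
    then have "H v = 0" by (simp add: Ev)
    show ?thesis
    proof (rule Suc.IH[of "\<lambda>b. c (k # b)" v])
      show "c (k # b) = 0" if "b \<notin> words m d" for b
        using that k by (intro Suc.prems(1)) (auto simp: words_def)
    qed (use \<open>H v = 0\<close> Suc.prems(3) in \<open>simp_all add: H_def\<close>)
  qed
  have zero: "c u = 0" if "u \<noteq> []" for u
  proof (cases u)
    case (Cons k b)
    then show ?thesis
      using tail[of k b] Suc.prems(1)[of u] by (cases "k \<in> {1..m}") (auto simp: words_def)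
  qed (use that in simp)
  have "word_sum (Suc d) c v = (\<Sum>u\<in>{[]}. c u *\<^sub>C nc_monomial x u v)"
    unfolding word_sum_def
    by (rule sum.mono_neutral_right) (auto simp: finite_words zero, simp add: words_def)
  with Suc.prems have "c [] = 0" by (simp add: nc_monomial_Nil scaleC_eq_0_iff)
  with zero show ?case by (cases "w = []") auto
qed

end


section \<open>Polynomials in a self-adjoint operator\<close>

text \<open>Horner's scheme, as for \<^const>\<open>poly\<close>, with composition of operators as the product.\<close>

definition opoly :: "'a::complex_inner operator \<Rightarrow> real poly \<Rightarrow> 'a operator" where
  "opoly T p = fold_coeffs (\<lambda>a f v. a *\<^sub>R v + T (f v)) p (\<lambda>v. 0)"

lemma opoly_0 [simp]: "opoly T 0 v = 0"
  by (simp add: opoly_def)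

context
  fixes T :: "'a::complex_inner operator"
  assumes T: "bounded_clinear T"
begin

lemma opoly_pCons [simp]: "opoly T (pCons a p) v = a *\<^sub>R v + T (opoly T p v)"
  by (cases "p = 0 \<and> a = 0") (auto simp: opoly_def bounded_clinear_zero[OF T])

lemma opoly_add: "opoly T (p + q) v = opoly T p v + opoly T q v"
  by (induction p q rule: poly_induct2) (simp_all add: bounded_clinear_add[OF T] algebra_simps)

lemma opoly_smult: "opoly T (smult a p) v = a *\<^sub>R opoly T p v"
  by (induction p) (simp_all add: bounded_clinear_scaleR[OF T] algebra_simps)

lemma opoly_mult: "opoly T (p * q) v = opoly T p (opoly T q v)"
  by (induction p) (simp_all add: opoly_add opoly_smult)

lemma opoly_power: "opoly T (p ^ k) v = (opoly T p ^^ k) v"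
  by (induction k) (simp_all add: opoly_mult bounded_clinear_zero[OF T] one_pCons)

lemma opoly_commute: "opoly T p (T v) = T (opoly T p v)"
  by (induction p) (simp_all add: bounded_clinear_add[OF T] bounded_clinear_scaleR[OF T]
      bounded_clinear_zero[OF T])

lemma opoly_selfadjoint:
  assumes "\<And>u v. cinner (T u) v = cinner u (T v)"
  shows "cinner (opoly T p u) v = cinner u (opoly T p v)"
  by (induction p arbitrary: u v) (simp_all add: cinner_add_left cinner_add_right cinner_scaleR_left
      cinner_scaleR_right assms opoly_commute[symmetric])

end

lemma (in tracial_algebra) opoly_mem:
  assumes T: "T \<in> \<A>" shows "opoly T p \<in> \<A>"
proof (induction p)
  case 0
  have "opoly T 0 = (\<lambda>v. 0)" by (rule ext) simp
  then show ?case by (simp add: zero_mem)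
next
  case (pCons a p)
  have "opoly T (pCons a p) = (\<lambda>v. a *\<^sub>R id v + (T \<circ> opoly T p) v)"
    by (rule ext) (simp add: opoly_pCons[OF bounded[OF T]])
  then show ?case
    using add_mem[OF scaleR_mem[OF id_mem] comp_mem[OF T pCons.IH]] by simp
qed

text \<open>For a self-adjoint operator the ratios \<open>\<parallel>S\<^sup>n\<^sup>+\<^sup>1 v\<parallel> / \<parallel>S\<^sup>n v\<parallel>\<close> increase, so that the first of them is at
  most the exponential rate of growth.\<close>

lemma selfadjoint_growth_bound:
  fixes S :: "'a::real_inner \<Rightarrow> 'a"
  assumes sa: "\<And>u v. inner (S u) v = inner u (S v)"
    and growth: "\<And>n. norm ((S ^^ n) v) \<le> C * B ^ n" and B: "0 \<le> B"
  shows "norm (S v) \<le> B * norm v"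
proof (rule ccontr)
  assume "\<not> norm (S v) \<le> B * norm v"
  then have less: "B * norm v < norm (S v)" by simp
  have log_convex: "(norm (S u))\<^sup>2 \<le> norm u * norm (S (S u))" for u
    using norm_cauchy_schwarz[of u "S (S u)"] by (simp add: power2_norm_eq_inner sa)
  have v: "norm v > 0" using log_convex[of v] less by (cases "v = 0") auto
  define r where "r = norm (S v) / norm v"
  have "r > B" using less v by (simp add: r_def pos_less_divide_eq)
  with B have r: "r > B" "r > 0" by simp_all
  have ratio: "(S ^^ n) v \<noteq> 0 \<and> r * norm ((S ^^ n) v) \<le> norm ((S ^^ Suc n) v)" for n
  proof (induction n)
    case 0
    then show ?case using v by (simp add: r_def)
  next
    case (Suc n)
    let ?u = "(S ^^ n) v"
    have u: "norm ?u > 0" and ru: "r * norm ?u \<le> norm (S ?u)" using Suc by auto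
    have "r * norm ?u * norm (S ?u) \<le> norm (S ?u) * norm (S ?u)" by (intro mult_right_mono ru) simp
    also have "\<dots> \<le> norm ?u * norm (S (S ?u))" using log_convex[of ?u] by (simp add: power2_eq_square)
    finally have "norm ?u * (r * norm (S ?u)) \<le> norm ?u * norm (S (S ?u))" by (simp add: ac_simps)
    then have "r * norm (S ?u) \<le> norm (S (S ?u))" using u by (simp only: mult_le_cancel_left_pos)
    moreover have "0 < r * norm ?u" using u r by simp
    with ru have "0 < norm (S ?u)" by linarith
    then have "S ?u \<noteq> 0" by simp
    ultimately show ?case by simp
  qed
  have lower: "r ^ n * norm v \<le> norm ((S ^^ n) v)" for n
  proof (induction n)
    case (Suc n)
    have "r ^ Suc n * norm v = r * (r ^ n * norm v)" by simp
    also have "\<dots> \<le> r * norm ((S ^^ n) v)" using Suc r by (intro mult_left_mono) auto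
    also have "\<dots> \<le> norm ((S ^^ Suc n) v)" using ratio by blast
    finally show ?case .
  qed simp
  have "norm v \<le> C * (B / r) ^ n" for n
  proof -
    have "norm v * r ^ n \<le> C * B ^ n" using lower[of n] growth[of n] by (simp add: mult.commute)
    then show ?thesis using r by (simp add: power_divide pos_le_divide_eq)
  qed
  moreover have "(\<lambda>n. C * (B / r) ^ n) \<longlonglongrightarrow> C * 0"
    using r B by (intro tendsto_mult tendsto_const LIMSEQ_power_zero) auto
  ultimately have "norm v \<le> 0" using LIMSEQ_le_const[of _ "C * 0" "norm v"] by auto
  with v show False by simp
qed


section \<open>Compactly supported distributions of operators\<close>

locale compactly_supported = prob_space \<mu> for \<mu> :: "real measure" +
  fixes K :: "real set"
  assumes sets_borel: "sets \<mu> = sets borel" and compact_K: "compact K"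
    and support: "emeasure \<mu> (- K) = 0"
begin

lemma AE_support: "AE t in \<mu>. t \<in> K"
proof (rule AE_I)
  show "{t \<in> space \<mu>. \<not> t \<in> K} \<subseteq> - K" by auto
  show "- K \<in> sets \<mu>" using compact_imp_closed[OF compact_K] by (auto simp: sets_borel)
qed (rule support)

lemma nonempty_support: "K \<noteq> {}"
proof
  assume "K = {}"
  then have "AE t in \<mu>. False" using AE_support by simp
  then show False by simp
qed

lemma continuous_measurable:
  fixes f :: "real \<Rightarrow> real"
  assumes "continuous_on UNIV f" shows "f \<in> borel_measurable \<mu>"
  using borel_measurable_continuous_onI[OF assms] sets_borel by (simp cong: measurable_cong_sets)

lemma continuous_integrable:
  fixes f :: "real \<Rightarrow> real"
  assumes f: "continuous_on UNIV f" shows "integrable \<mu> f"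
proof -
  have "compact (f ` K)"
    using compact_K continuous_on_subset[OF f] by (intro compact_continuous_image) auto
  then obtain B where "\<And>t. t \<in> K \<Longrightarrow> norm (f t) \<le> B"
    using compact_imp_bounded[of "f ` K"] by (auto simp: bounded_iff)
  then show ?thesis
    using AE_support by (intro integrable_const_bound[of _ B] continuous_measurable[OF f]) auto
qed

lemma continuous_integral_le:
  fixes f g :: "real \<Rightarrow> real"
  assumes "continuous_on UNIV f" "continuous_on UNIV g" "\<And>t. t \<in> K \<Longrightarrow> f t \<le> g t"
  shows "(\<integral>t. f t \<partial>\<mu>) \<le> (\<integral>t. g t \<partial>\<mu>)"
  using AE_support by (intro integral_mono_AE continuous_integrable assms) (auto simp: assms(3))

lemma continuous_integral_le_const:
  fixes f :: "real \<Rightarrow> real"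
  assumes "continuous_on UNIV f" "\<And>t. t \<in> K \<Longrightarrow> f t \<le> B"
  shows "(\<integral>t. f t \<partial>\<mu>) \<le> B"
proof -
  have "(\<integral>t. f t \<partial>\<mu>) \<le> (\<integral>t. B \<partial>\<mu>)"
    by (rule continuous_integral_le) (auto intro: assms)
  then show ?thesis by (simp add: prob_space)
qed

end


locale distributed_element = tracial_algebra \<A> e + compactly_supported \<mu> K
  for \<A> :: "'h::chilbert_space operator set" and e and \<mu> K +
  fixes T :: "'h operator"
  assumes T_mem: "T \<in> \<A>" and T_selfadjoint: "cadjoint T = T"
    and moments: "complex_of_real (\<integral>t. t ^ k \<partial>\<mu>) = cinner e ((T ^^ k) e)"
begin

lemma T_bounded: "bounded_clinear T"
  by (rule bounded[OF T_mem])

lemma cinner_T: "cinner (T u) v = cinner u (T v)"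
  using cadjoint_works[OF T_bounded] T_selfadjoint by simp

lemma integral_poly: "complex_of_real (\<integral>t. poly p t \<partial>\<mu>) = cinner e (opoly T p e)"
proof -
  have "complex_of_real (\<integral>t. t ^ k * poly p t \<partial>\<mu>) = cinner e (opoly T p ((T ^^ k) e))" for k
  proof (induction p arbitrary: k)
    case (pCons a p)
    have "(\<integral>t. t ^ k * poly (pCons a p) t \<partial>\<mu>) = (\<integral>t. a * t ^ k + t ^ Suc k * poly p t \<partial>\<mu>)"
      by (simp add: algebra_simps)
    also have "\<dots> = a * (\<integral>t. t ^ k \<partial>\<mu>) + (\<integral>t. t ^ Suc k * poly p t \<partial>\<mu>)"
      by (subst Bochner_Integration.integral_add)
        (auto intro!: continuous_integrable continuous_intros simp del: power_Suc)
    finally have "complex_of_real (\<integral>t. t ^ k * poly (pCons a p) t \<partial>\<mu>)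
        = of_real a * cinner e ((T ^^ k) e) + cinner e (opoly T p ((T ^^ Suc k) e))"
      using moments[of k] pCons.IH[of "Suc k"] by simp
    then show ?case
      by (simp add: opoly_pCons[OF T_bounded] opoly_commute[OF T_bounded] cinner_add_right
          cinner_scaleR_right)
  qed simp
  from this[of 0] show ?thesis by simp
qed

text \<open>On vectors \<open>Q e\<close> with \<open>Q\<close> in the commutant, the growth of the powers of \<open>p(T)\<close> is read off from the
  moments \<open>\<integral> p\<^sup>2\<^sup>n d\<mu>\<close>.\<close>

lemma opoly_norm_le:
  assumes p: "\<And>t. t \<in> K \<Longrightarrow> \<bar>poly p t\<bar> \<le> B"
  shows "norm (opoly T p v) \<le> B * norm v"
proof -
  let ?S = "opoly T p"
  have S: "?S \<in> \<A>" by (rule opoly_mem[OF T_mem])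
  have sa: "cinner (?S u) v = cinner u (?S v)" for u v
    by (rule opoly_selfadjoint[OF T_bounded cinner_T])
  have sa_pow: "cinner ((?S ^^ n) u) v = cinner u ((?S ^^ n) v)" for n u v
    by (induction n arbitrary: u v) (simp_all add: sa funpow_swap1)
  have B: "0 \<le> B" using p nonempty_support by force
  have pow: "norm ((?S ^^ n) e) \<le> B ^ n" for n
  proof -
    have "complex_of_real ((norm ((?S ^^ n) e))\<^sup>2) = cinner e ((?S ^^ (n + n)) e)"
      by (simp add: cinner_self[symmetric] sa_pow funpow_add del: of_real_power)
    also have "\<dots> = complex_of_real (\<integral>t. poly (p ^ (n + n)) t \<partial>\<mu>)"
      unfolding integral_poly opoly_power[OF T_bounded] ..
    finally have "(norm ((?S ^^ n) e))\<^sup>2 = (\<integral>t. poly (p ^ (n + n)) t \<partial>\<mu>)"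
      using of_real_eq_iff by blast
    also have "\<dots> \<le> (B ^ n)\<^sup>2"
    proof (rule continuous_integral_le_const)
      fix t assume "t \<in> K"
      have "poly (p ^ (n + n)) t = (\<bar>poly p t\<bar> ^ n)\<^sup>2"
        by (simp add: power_add power2_eq_square power_abs[symmetric])
      also have "\<dots> \<le> (B ^ n)\<^sup>2" by (intro power_mono p[OF \<open>t \<in> K\<close>]) auto
      finally show "poly (p ^ (n + n)) t \<le> (B ^ n)\<^sup>2" .
    qed (intro continuous_intros)
    finally show ?thesis using B by (simp add: power2_le_iff_abs_le)
  qed
  have dense: "norm (?S (Q e)) \<le> B * norm (Q e)" if Q: "Q \<in> commutant \<A>" for Q
  proof -
    obtain C where C: "\<And>u. norm (Q u) \<le> C * norm u" "0 < C"
      using bounded_clinear_bound[OF commutantD(2)[OF Q]] by metis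
    show ?thesis
    proof (rule selfadjoint_growth_bound)
      fix n
      have "norm ((?S ^^ n) (Q e)) = norm (Q ((?S ^^ n) e))"
        using commutantD(1)[OF Q funpow_mem[OF S]] by simp
      also have "\<dots> \<le> C * norm ((?S ^^ n) e)" by (rule C)
      also have "\<dots> \<le> C * B ^ n" using pow C by (intro mult_left_mono) auto
      finally show "norm ((?S ^^ n) (Q e)) \<le> C * B ^ n" .
    qed (use B sa in \<open>simp_all add: inner_eq_Re_cinner\<close>)
  qed
  have "closed {v. norm (?S v) \<le> B * norm v}"
    by (intro closed_Collect_le continuous_intros bounded_clinear_continuous bounded[OF S])
  then have "closure {Q e |Q. Q \<in> commutant \<A>} \<subseteq> {v. norm (?S v) \<le> B * norm v}"
    by (rule closure_minimal[rotated]) (use dense in auto)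
  then show ?thesis using commutant_dense by auto
qed

text \<open>Even powers of \<open>1 - t\<^sup>2/c\<^sup>2\<close> are nonnegative and take the value \<open>1\<close> at \<open>0\<close>, so that their integrals bound
  the mass of \<open>0\<close>. When \<open>\<parallel>T\<parallel> \<le> c\<close>, the same powers of \<open>1 - T\<^sup>2/c\<^sup>2\<close> converge to the projection onto the
  kernel of \<open>T\<close>.\<close>

lemma no_atom_at_zero:
  assumes inj: "\<And>v. T v = 0 \<Longrightarrow> v = 0"
  shows "measure \<mu> {0} = 0"
proof -
  obtain c where c: "c > 0" "\<And>v. norm (T v) \<le> c * norm v"
    using bounded_clinear_bound[OF T_bounded] by metis
  have ctx: "bounded_clinear T" "bounded_clinear (cadjoint T)" "c > 0" "\<And>v. norm (T v) \<le> c * norm v"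
    using c T_bounded by (simp_all add: T_selfadjoint)
  let ?q = "[:1, 0, - (1 / c\<^sup>2):]"
  have q: "poly ?q t = 1 - (t / c)\<^sup>2" for t
    by (simp add: power2_eq_square)
  have "opoly T ?q v = damping T c v" for v
    by (simp add: damping_def T_selfadjoint opoly_pCons[OF T_bounded] bounded_clinear_zero[OF T_bounded]
        bounded_clinear_minus[OF T_bounded] bounded_clinear_scaleR[OF T_bounded])
  then have op: "opoly T ?q = damping T c" by (rule ext)
  have "kernel_projection T c e = 0" by (rule inj[OF apply_kernel_projection[OF ctx]])
  then have "(\<lambda>n. cinner e ((damping T c ^^ (2 * n)) e)) \<longlonglongrightarrow> cinner e 0"
    using kernel_projection_tendsto[OF ctx, of e] by (intro tendsto_cinner tendsto_const) simp
  then have "(\<lambda>n. complex_of_real (\<integral>t. poly (?q ^ (2 * n)) t \<partial>\<mu>)) \<longlonglongrightarrow> 0"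
    unfolding integral_poly opoly_power[OF T_bounded] op by simp
  then have lim: "(\<lambda>n. \<integral>t. poly (?q ^ (2 * n)) t \<partial>\<mu>) \<longlonglongrightarrow> 0"
    using tendsto_Re by fastforce
  have le: "measure \<mu> {0} \<le> (\<integral>t. poly (?q ^ (2 * n)) t \<partial>\<mu>)" for n
  proof -
    have m0: "{0} \<in> sets \<mu>" by (simp add: sets_borel)
    have "measure \<mu> {0} = (\<integral>t. indicator {0} t \<partial>\<mu>)" using m0 by simp
    also have "\<dots> \<le> (\<integral>t. poly (?q ^ (2 * n)) t \<partial>\<mu>)"
    proof (rule integral_mono)
      show "indicator {0} t \<le> poly (?q ^ (2 * n)) t" for t :: real
        by (cases "t = 0") (simp_all add: poly_power power_mult)
    qed (use m0 c(1) in \<open>auto intro!: continuous_integrable continuous_intros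
        simp: integrable_indicator_iff emeasure_eq_measure\<close>)
    finally show ?thesis .
  qed
  have "measure \<mu> {0} \<le> 0" by (rule LIMSEQ_le_const[OF lim]) (use le in auto)
  then show ?thesis by (simp add: measure_le_0_iff)
qed

end


section \<open>The commutator estimate\<close>

locale distributed_polynomial = dual_family \<A> e x R m + distributed_element \<A> e \<mu> K T
  for \<A> :: "'h::chilbert_space operator set" and e x R m \<mu> K T +
  fixes d :: nat and c :: "nat list \<Rightarrow> complex"
  assumes coeff_support: "w \<notin> words m (Suc d) \<Longrightarrow> c w = 0"
    and T_eq: "T = word_sum (Suc d) c"
begin

text \<open>The commutator \<open>[R\<^sub>j, T]\<close> has finite rank, and \<open>S [R\<^sub>j, T] S\<close> with \<open>S = p(T)\<close> equals
  \<open>S R\<^sub>j (T - s) S - S (T - s) R\<^sub>j S\<close>, whose norm is small when \<open>p\<close> is concentrated near \<open>s\<close>. Its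
  trace against the right multiplication \<open>Q\<close> by \<open>x\<^sub>j\<close> is the trace of \<open>p(T)\<^sup>2\<close> times the polynomial
  obtained from \<open>T\<close> by putting the letter \<open>j\<close> back at each of its occurrences, which is the number
  operator applied to \<open>T\<close>.\<close>

theorem commutator_estimate:
  assumes j: "j \<in> {1..m}"
    and eigen: "\<And>v. word_sum (Suc d) (\<lambda>w. of_nat (count_list w j) * c w) v = l *\<^sub>C T v"
  shows "\<exists>C\<ge>0. \<forall>p s B B'. (\<forall>t\<in>K. \<bar>poly p t\<bar> \<le> B) \<and> (\<forall>t\<in>K. \<bar>(t - s) * poly p t\<bar> \<le> B') \<longrightarrow>
      cmod l * \<bar>\<integral>t. (poly p t)\<^sup>2 * t \<partial>\<mu>\<bar> \<le> C * B * B'"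
proof -
  obtain Q where Q: "Q \<in> commutant \<A>" and Qe: "Q e = x j e"
    using commutant_vector[OF generator_mem[OF j]] by blast
  note bQ = commutantD(2)[OF Q] and QA = commutantD(1)[OF Q]
  note bR = bounded_dual[OF j] and bT = T_bounded
  obtain q where q: "q > 0" "\<And>v. norm (Q v) \<le> q * norm v"
    using bounded_clinear_bound[OF bQ] by metis
  obtain r where r: "r > 0" "\<And>v. norm (R j v) \<le> r * norm v"
    using bounded_clinear_bound[OF bR] by metis
  define I where "I = words m d \<times> words m d"
  have I: "finite I" by (simp add: I_def finite_words)
  have mon: "nc_monomial x a \<in> \<A>" if "a \<in> words m d" for a
    using that by (auto simp: words_def intro!: monomial_mem)
  show ?thesis
  proof (intro exI[of _ "card I * (2 * q * r)"] conjI allI impI; (elim conjE)?)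
    show "0 \<le> card I * (2 * q * r)" using q r by simp
  next
    fix p s B B'
    assume p: "\<forall>t\<in>K. \<bar>poly p t\<bar> \<le> B" and p': "\<forall>t\<in>K. \<bar>(t - s) * poly p t\<bar> \<le> B'"
    have B: "0 \<le> B" "0 \<le> B'" using p p' nonempty_support by force+
    define S S' where "S = opoly T p" and "S' = opoly T ([:- s, 1:] * p)"
    have S: "S \<in> \<A>" and S': "S' \<in> \<A>" unfolding S_def S'_def by (rule opoly_mem[OF T_mem])+
    note bS = bounded[OF S] and bS' = bounded[OF S']
    have S_norm: "norm (S v) \<le> B * norm v" for v
      unfolding S_def by (rule opoly_norm_le) (use p in blast)
    have S'_norm: "norm (S' v) \<le> B' * norm v" for v
      unfolding S'_def by (rule opoly_norm_le) (use p' in \<open>simp add: algebra_simps\<close>)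
    have S_sa: "cinner (S u) v = cinner u (S v)" for u v
      unfolding S_def by (rule opoly_selfadjoint[OF bT cinner_T])
    have S'1: "T (S v) = S' v + s *\<^sub>R S v" for v
      unfolding S_def S'_def opoly_mult[OF bT]
      by (simp add: opoly_pCons[OF bT] bounded_clinear_zero[OF bT])
    have ST: "T (S v) = S (T v)" for v by (simp add: S_def opoly_commute[OF bT])
    have S'2: "S (T v) = S' v + s *\<^sub>R S v" for v using S'1[of v] by (simp add: ST)
    define \<beta> where "\<beta> = (\<lambda>(a :: nat list, b). S (cadjoint (nc_monomial x b) e))"
    define \<gamma> where "\<gamma> = (\<lambda>(a, b). c (a @ j # b) *\<^sub>C Q (S (nc_monomial x a e)))"
    have operator: "(\<Sum>i\<in>I. cinner (\<beta> i) v *\<^sub>C \<gamma> i) = Q (S (R j (S' v)) - S' (R j (S v)))" for v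
    proof -
      have "(\<Sum>i\<in>I. cinner (\<beta> i) v *\<^sub>C \<gamma> i) = (\<Sum>a\<in>words m d. \<Sum>b\<in>words m d.
          cinner (\<beta> (a, b)) v *\<^sub>C \<gamma> (a, b))"
        unfolding I_def by (simp add: sum.cartesian_product)
      also have "\<dots> = (\<Sum>a\<in>words m d. \<Sum>b\<in>words m d.
          Q (S (c (a @ j # b) *\<^sub>C cinner e (nc_monomial x b (S v)) *\<^sub>C nc_monomial x a e)))"
        by (intro sum.cong refl) (simp add: \<beta>_def \<gamma>_def S_sa cadjoint_works_left[OF bounded[OF mon]]
            bounded_clinear_scaleC[OF bS] bounded_clinear_scaleC[OF bQ] scaleC_scaleC mult.commute)
      also have "\<dots> = Q (S (\<Sum>a\<in>words m d. \<Sum>b\<in>words m d.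
          c (a @ j # b) *\<^sub>C cinner e (nc_monomial x b (S v)) *\<^sub>C nc_monomial x a e))"
        by (simp add: bounded_clinear_sum[OF bS] bounded_clinear_sum[OF bQ])
      also have "(\<Sum>a\<in>words m d. \<Sum>b\<in>words m d.
          c (a @ j # b) *\<^sub>C cinner e (nc_monomial x b (S v)) *\<^sub>C nc_monomial x a e)
        = R j (T (S v)) - T (R j (S v))"
        unfolding T_eq by (rule dual_word_sum[OF _ j, symmetric]) (rule coeff_support)
      also have "S (R j (T (S v)) - T (R j (S v))) = S (R j (S' v)) - S' (R j (S v))"
        by (simp add: S'1 S'2 bounded_clinear_diff[OF bS] bounded_clinear_add[OF bS]
            bounded_clinear_add[OF bR] bounded_clinear_scaleR[OF bS] bounded_clinear_scaleR[OF bR])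
      finally show ?thesis .
    qed
    have bound: "norm (\<Sum>i\<in>I. cinner (\<beta> i) v *\<^sub>C \<gamma> i) \<le> (2 * q * r * B * B') * norm v" for v
    proof -
      have "norm (S (R j (S' v))) \<le> B * (r * (B' * norm v))"
        using B r by (intro order_trans[OF S_norm] mult_left_mono order_trans[OF r(2)] S'_norm) auto
      moreover have "norm (S' (R j (S v))) \<le> B' * (r * (B * norm v))"
        using B r by (intro order_trans[OF S'_norm] mult_left_mono order_trans[OF r(2)] S_norm) auto
      ultimately have "norm (S (R j (S' v)) - S' (R j (S v))) \<le> 2 * r * B * B' * norm v"
        by (intro order_trans[OF norm_triangle_ineq4]) (simp add: ac_simps)
      then have "norm (Q (S (R j (S' v)) - S' (R j (S v)))) \<le> q * (2 * r * B * B' * norm v)"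
        using q by (intro order_trans[OF q(2)] mult_left_mono) auto
      then show ?thesis unfolding operator by (simp add: ac_simps)
    qed
    have "(\<Sum>i\<in>I. cinner (\<beta> i) (\<gamma> i)) = (\<Sum>a\<in>words m d. \<Sum>b\<in>words m d. cinner (\<beta> (a, b)) (\<gamma> (a, b)))"
      unfolding I_def by (simp add: sum.cartesian_product)
    also have "\<dots> = (\<Sum>a\<in>words m d. \<Sum>b\<in>words m d.
        cinner e (S (S (c (a @ j # b) *\<^sub>C nc_monomial x (a @ j # b) e))))"
    proof (intro sum.cong refl)
      fix a b assume ab: "a \<in> words m d" "b \<in> words m d"
      let ?a = "nc_monomial x a" and ?b = "nc_monomial x b"
      have "cinner (cadjoint ?b e) (S (Q (S (?a e)))) = cinner e (?b ((S \<circ> (S \<circ> (?a \<circ> x j))) e))"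
        using QA[OF S] QA[OF mon[OF ab(1)]]
        by (simp add: cadjoint_works_left[OF bounded[OF mon[OF ab(2)]]] Qe[symmetric])
      also have "\<dots> = cinner e ((S \<circ> (S \<circ> (?a \<circ> x j))) (?b e))"
        by (intro trace comp_mem S mon ab generator_mem j)
      also have "\<dots> = cinner e (S (S (nc_monomial x (a @ j # b) e)))"
        by (simp add: nc_monomial_append nc_monomial_Cons)
      finally show "cinner (\<beta> (a, b)) (\<gamma> (a, b))
          = cinner e (S (S (c (a @ j # b) *\<^sub>C nc_monomial x (a @ j # b) e)))"
        by (simp add: \<beta>_def \<gamma>_def S_sa cinner_scaleC_right bounded_clinear_scaleC[OF bS])
    qed
    also have "\<dots> = cinner e (S (S (\<Sum>a\<in>words m d. \<Sum>b\<in>words m d.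
        c (a @ j # b) *\<^sub>C nc_monomial x (a @ j # b) e)))"
      by (simp add: bounded_clinear_sum[OF bS] cinner_sum_right)
    also have "(\<Sum>a\<in>words m d. \<Sum>b\<in>words m d. c (a @ j # b) *\<^sub>C nc_monomial x (a @ j # b) e)
      = (\<Sum>w\<in>words m (Suc d). c w *\<^sub>C (\<Sum>(a, b)\<in>splits j w. nc_monomial x (a @ j # b) e))"
      by (rule sum_words_splits[symmetric]) (rule coeff_support)
    also have "\<dots> = word_sum (Suc d) (\<lambda>w. of_nat (count_list w j) * c w) e"
      unfolding word_sum_def
    proof (rule sum.cong)
      fix w
      have "(\<Sum>(a, b)\<in>splits j w. nc_monomial x (a @ j # b) e) = (\<Sum>p\<in>splits j w. nc_monomial x w e)"
        by (rule sum.cong) (auto simp: splits_def)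
      also have "\<dots> = of_nat (count_list w j) *\<^sub>C nc_monomial x w e"
        by (simp add: sum_constant_scaleR card_splits scaleR_eq_scaleC)
      finally show "c w *\<^sub>C (\<Sum>(a, b)\<in>splits j w. nc_monomial x (a @ j # b) e)
          = (of_nat (count_list w j) * c w) *\<^sub>C nc_monomial x w e"
        by (simp add: scaleC_scaleC mult.commute)
    qed simp
    also have "\<dots> = l *\<^sub>C T e" by (rule eigen)
    also have "cinner e (S (S (l *\<^sub>C T e))) = l * cinner e (opoly T (p * (p * [:0, 1:])) e)"
      by (simp add: S_def[symmetric] ST bounded_clinear_scaleC[OF bS] cinner_scaleC_right
          opoly_mult[OF bT] opoly_pCons[OF bT] bounded_clinear_zero[OF bT])
    also have "\<dots> = l * complex_of_real (\<integral>t. poly (p * (p * [:0, 1:])) t \<partial>\<mu>)"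
      by (simp only: integral_poly)
    also have "(\<lambda>t. poly (p * (p * [:0, 1:])) t) = (\<lambda>t. (poly p t)\<^sup>2 * t)"
      by (rule ext) (simp add: power2_eq_square algebra_simps)
    finally have "cmod (\<Sum>i\<in>I. cinner (\<beta> i) (\<gamma> i)) = cmod l * \<bar>\<integral>t. (poly p t)\<^sup>2 * t \<partial>\<mu>\<bar>"
      by (simp add: norm_mult)
    moreover have "cmod (\<Sum>i\<in>I. cinner (\<beta> i) (\<gamma> i)) \<le> card I * (2 * q * r * B * B')"
      using q r B bound by (intro finite_rank_trace_bound I) auto
    ultimately show "cmod l * \<bar>\<integral>t. (poly p t)\<^sup>2 * t \<partial>\<mu>\<bar> \<le> card I * (2 * q * r) * B * B'"
      by (simp add: ac_simps)
  qed
qed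

end


section \<open>Absolute continuity from polynomial test functions\<close>

context compactly_supported
begin

text \<open>The polynomials approximate a trapezoid that is \<open>1\<close> on \<open>[a, b]\<close> and whose support has length
  comparable to \<open>b - a\<close> and stays on one side of \<open>0\<close>. The sign \<open>\<sigma>\<close> says on which side.\<close>

lemma interval_bound:
  assumes C: "0 \<le> C"
    and est: "\<And>p s B B'. \<forall>t\<in>K. \<bar>poly p t\<bar> \<le> B \<Longrightarrow> \<forall>t\<in>K. \<bar>(t - s) * poly p t\<bar> \<le> B' \<Longrightarrow>
      \<bar>\<integral>t. (poly p t)\<^sup>2 * t \<partial>\<mu>\<bar> \<le> C * B * B'"
    and \<sigma>: "\<sigma> = 1 \<or> \<sigma> = -1" and r: "0 < r" and ab: "a < b" and away: "\<And>t. t \<in> {a..b} \<Longrightarrow> r \<le> \<sigma> * t"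
  shows "r * measure \<mu> {a..b} \<le> (5 * C + 1) * (b - a)"
proof -
  \<comment> \<open>With \<open>\<delta> \<le> r\<close> the trapezoid does not reach beyond \<open>0\<close>.\<close>
  define \<delta> where "\<delta> = min r (b - a)"
  define s where "s = (a + b) / 2"
  have \<delta>: "0 < \<delta>" "\<delta> \<le> r" "\<delta> \<le> b - a" using r ab by (auto simp: \<delta>_def)
  define f where "f t = max 0 (1 - max 0 (max (a - t) (t - b)) / \<delta>)" for t
  have cf: "continuous_on X f" for X unfolding f_def by (intro continuous_intros) (use \<delta> in auto)
  have f01: "0 \<le> f t" "f t \<le> 1" for t using \<delta> by (auto simp: f_def)
  have f1: "f t = 1" if "t \<in> {a..b}" for t using that by (auto simp: f_def)
  have f_supp: "a - \<delta> < t \<and> t < b + \<delta>" if "f t \<noteq> 0" for t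
  proof -
    have "max 0 (max (a - t) (t - b)) / \<delta> < 1"
    proof (rule ccontr)
      assume "\<not> ?thesis"
      then have "f t = 0" unfolding f_def by (intro max_absorb1) linarith
      with that show False by simp
    qed
    then have "max 0 (max (a - t) (t - b)) < \<delta>" using \<delta> by (simp add: pos_divide_less_eq)
    then show ?thesis by auto
  qed
  have f_sign: "0 \<le> \<sigma> * t" if "f t \<noteq> 0" for t
    using f_supp[OF that] away[of a] away[of b] \<sigma> ab \<delta> by auto
  have f_s: "\<bar>t - s\<bar> * f t \<le> 3 / 2 * (b - a)" for t
  proof (cases "f t = 0")
    case False
    have "\<bar>t - s\<bar> \<le> 3 / 2 * (b - a)" using f_supp[OF False] \<delta> by (auto simp: s_def abs_if field_simps)
    then have "\<bar>t - s\<bar> * f t \<le> 3 / 2 * (b - a) * 1" using f01[of t] ab by (intro mult_mono) auto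
    then show ?thesis by simp
  qed (use ab in simp)
  obtain L where L: "0 < L" "\<And>t. t \<in> K \<Longrightarrow> \<bar>t\<bar> \<le> L"
    using compact_imp_bounded[OF compact_K] by (auto simp: bounded_pos)
  define M where "M = L + \<bar>s\<bar>"
  have M: "0 < M" "\<And>t. t \<in> K \<Longrightarrow> \<bar>t - s\<bar> \<le> M" using L by (force simp: M_def)+
  \<comment> \<open>The error of approximation is made small compared with \<open>b - a\<close>, so that it only changes the constant.\<close>
  define \<epsilon> where "\<epsilon> = min 1 (min ((b - a) / (3 * L)) ((b - a) / M))"
  have \<epsilon>: "0 < \<epsilon>" "\<epsilon> \<le> 1" using L M ab by (auto simp: \<epsilon>_def)
  have "\<epsilon> \<le> (b - a) / (3 * L)" "\<epsilon> \<le> (b - a) / M" by (auto simp: \<epsilon>_def)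
  then have \<epsilon>L: "3 * L * \<epsilon> \<le> b - a" and \<epsilon>M: "M * \<epsilon> \<le> b - a"
    using L M by (simp_all add: pos_le_divide_eq mult.commute)
  obtain g where "real_polynomial_function g" and fg: "\<And>t. t \<in> K \<Longrightarrow> \<bar>f t - g t\<bar> < \<epsilon>"
    using Stone_Weierstrass_real_polynomial_function[OF compact_K cf \<epsilon>(1)] by metis
  then obtain c n where g: "g = (\<lambda>t. \<Sum>i\<le>n. c i * t ^ i)"
    using real_polynomial_function_iff_sum by blast
  define p where "p = (\<Sum>i\<le>n. monom (c i) i)"
  have "g t = poly p t" for t by (simp add: g p_def poly_sum poly_monom)
  with fg have fp: "\<bar>f t - poly p t\<bar> \<le> \<epsilon>" if "t \<in> K" for t using that by (simp add: less_imp_le)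
  have p2: "\<bar>poly p t\<bar> \<le> 2" if "t \<in> K" for t using fp[OF that] f01[of t] \<epsilon> by linarith
  have ps: "\<bar>(t - s) * poly p t\<bar> \<le> 5 / 2 * (b - a)" if t: "t \<in> K" for t
  proof -
    have "\<bar>(t - s) * poly p t\<bar> \<le> \<bar>(t - s) * f t\<bar> + \<bar>(t - s) * (f t - poly p t)\<bar>"
      using abs_triangle_ineq4[of "(t - s) * f t" "(t - s) * (f t - poly p t)"] by (simp add: algebra_simps)
    also have "\<dots> = \<bar>t - s\<bar> * f t + \<bar>t - s\<bar> * \<bar>f t - poly p t\<bar>" using f01[of t] by (simp add: abs_mult)
    finally have "\<bar>(t - s) * poly p t\<bar> \<le> \<bar>t - s\<bar> * f t + \<bar>t - s\<bar> * \<bar>f t - poly p t\<bar>" .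
    moreover have "\<bar>t - s\<bar> * \<bar>f t - poly p t\<bar> \<le> M * \<epsilon>"
      using M t fp[OF t] by (intro mult_mono) auto
    ultimately show ?thesis using f_s[of t] \<epsilon>M by argo
  qed
  have main: "\<bar>\<integral>t. (poly p t)\<^sup>2 * t \<partial>\<mu>\<bar> \<le> C * 2 * (5 / 2 * (b - a))"
    using p2 ps by (intro est) auto
  have mab: "{a..b} \<in> sets \<mu>" by (simp add: sets_borel)
  have "r * measure \<mu> {a..b} = (\<integral>t. r * indicator {a..b} t \<partial>\<mu>)" using mab by simp
  also have "\<dots> \<le> (\<integral>t. (f t)\<^sup>2 * (\<sigma> * t) \<partial>\<mu>)"
  proof (rule integral_mono)
    show "r * indicator {a..b} t \<le> (f t)\<^sup>2 * (\<sigma> * t)" for t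
      using f1[of t] away[of t] f_sign[of t] r by (cases "t \<in> {a..b}"; cases "f t = 0") auto
  qed (use mab in \<open>auto intro!: continuous_integrable continuous_intros cf
      simp: integrable_indicator_iff emeasure_eq_measure\<close>)
  also have "\<dots> \<le> (\<integral>t. \<sigma> * ((poly p t)\<^sup>2 * t) + 3 * L * \<epsilon> \<partial>\<mu>)"
  proof (rule continuous_integral_le)
    fix t assume t: "t \<in> K"
    have "(f t)\<^sup>2 * (\<sigma> * t) - \<sigma> * ((poly p t)\<^sup>2 * t) = (f t - poly p t) * (f t + poly p t) * (\<sigma> * t)"
      by (simp add: power2_eq_square algebra_simps)
    also have "\<dots> \<le> \<bar>f t - poly p t\<bar> * \<bar>f t + poly p t\<bar> * \<bar>\<sigma> * t\<bar>"
      by (metis abs_ge_self abs_mult)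
    also have "\<dots> \<le> \<epsilon> * 3 * L"
    proof (intro mult_mono fp t)
      show "\<bar>f t + poly p t\<bar> \<le> 3" using p2[OF t] f01[of t] by linarith
      show "\<bar>\<sigma> * t\<bar> \<le> L" using \<sigma> L(2)[OF t] by auto
    qed (use \<epsilon> in auto)
    finally show "(f t)\<^sup>2 * (\<sigma> * t) \<le> \<sigma> * ((poly p t)\<^sup>2 * t) + 3 * L * \<epsilon>" by (simp add: ac_simps)
  qed (intro continuous_intros cf)+
  also have "\<dots> = \<sigma> * (\<integral>t. (poly p t)\<^sup>2 * t \<partial>\<mu>) + 3 * L * \<epsilon>"
    by (subst Bochner_Integration.integral_add)
      (auto intro!: continuous_integrable continuous_intros simp: prob_space)
  also have "\<dots> \<le> \<bar>\<integral>t. (poly p t)\<^sup>2 * t \<partial>\<mu>\<bar> + 3 * L * \<epsilon>" using \<sigma> by auto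
  also have "\<dots> \<le> (5 * C + 1) * (b - a)" using main \<epsilon>L by (simp add: algebra_simps)
  finally show ?thesis .
qed

text \<open>A null set that avoids a neighbourhood of \<open>0\<close> is covered by countably many non-overlapping intervals of small
  total length that still avoid a smaller neighbourhood of \<open>0\<close>, and the bound applies to each of them.\<close>

lemma null_away_from_zero:
  assumes bound: "\<And>a b. a < b \<Longrightarrow> (\<And>t. t \<in> {a..b} \<Longrightarrow> r \<le> \<sigma> * t) \<Longrightarrow> r * measure \<mu> {a..b} \<le> C * (b - a)"
    and C: "0 \<le> C" and r: "0 < r" and \<sigma>: "\<sigma> = 1 \<or> \<sigma> = -1"
    and A: "A \<in> null_sets lborel" "A \<subseteq> {t. 2 * r \<le> \<sigma> * t \<and> \<bar>t\<bar> \<le> L}"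
  shows "A \<in> null_sets \<mu>"
proof -
  have A_borel: "A \<in> sets borel" and A0: "emeasure lborel A = 0" using A(1) by (auto simp: null_sets_def)
  have small: "emeasure \<mu> A \<le> ennreal (C / r) * ennreal \<epsilon>" if \<epsilon>: "0 < \<epsilon>" for \<epsilon>
  proof -
    obtain U where U: "open U" "A \<subseteq> U" "emeasure lborel (U - A) < ennreal \<epsilon>"
      using outer_regular_lborel[OF A_borel \<epsilon>] .
    have "emeasure lborel U \<le> emeasure lborel A + emeasure lborel (U - A)"
      using U A_borel by (subst plus_emeasure) (auto simp: Un_absorb1 borel_open)
    then have U_le: "emeasure lborel U \<le> ennreal \<epsilon>" using A0 U(3) by simp
    define g where "g x = (if x \<in> U then U \<inter> ball x r else UNIV)" for x
    have "gauge g" using U(1) r by (auto simp: gauge_def g_def)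
    moreover have "A \<subseteq> cbox (- (\<bar>L\<bar> + 1)) (\<bar>L\<bar> + 1)"
    proof
      fix t assume "t \<in> A"
      then have "\<bar>t\<bar> \<le> L" using A(2) by auto
      then show "t \<in> cbox (- (\<bar>L\<bar> + 1)) (\<bar>L\<bar> + 1)" by auto
    qed
    moreover have "box (- (\<bar>L\<bar> + 1)) (\<bar>L\<bar> + 1) \<noteq> {}" by (simp add: box_eq_empty)
    ultimately obtain \<D> where \<D>: "countable \<D>"
      "\<And>D. D \<in> \<D> \<Longrightarrow> interior D \<noteq> {} \<and> (\<exists>c d. D = cbox c d)"
      "pairwise (\<lambda>A B. interior A \<inter> interior B = {}) \<D>"
      "\<And>D. D \<in> \<D> \<Longrightarrow> \<exists>x \<in> A \<inter> D. D \<subseteq> g x" "A \<subseteq> \<Union>\<D>"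
      using covering_lemma by metis
    have piece: "D \<in> sets \<mu> \<and> interior D \<subseteq> U \<and>
        emeasure \<mu> D \<le> ennreal (C / r) * emeasure lborel (interior D)" if D: "D \<in> \<D>" for D
    proof -
      obtain a b where ab: "D = {a..b}" using \<D>(2)[OF D] by auto
      then have "a < b" using \<D>(2)[OF D] by (auto simp: interior_atLeastAtMost_real)
      obtain x where x: "x \<in> A" "D \<subseteq> U \<inter> ball x r"
        using \<D>(4)[OF D] U(2) by (auto simp: g_def split: if_splits)
      have "r * measure \<mu> {a..b} \<le> C * (b - a)"
      proof (rule bound[OF \<open>a < b\<close>])
        fix t assume "t \<in> {a..b}"
        then have "\<bar>x - t\<bar> < r" using x(2) ab by (auto simp: dist_real_def)
        moreover have "2 * r \<le> \<sigma> * x" using x(1) A(2) by auto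
        ultimately show "r \<le> \<sigma> * t" using \<sigma> by auto
      qed
      then have "measure \<mu> {a..b} \<le> C / r * (b - a)" using r by (simp add: field_simps)
      then have "emeasure \<mu> D \<le> ennreal (C / r * (b - a))"
        by (simp add: ab emeasure_eq_measure ennreal_leI)
      also have "\<dots> = ennreal (C / r) * emeasure lborel (interior D)"
        using \<open>a < b\<close> C r by (subst ennreal_mult) (auto simp: ab)
      finally show ?thesis using x(2) interior_subset[of D] by (auto simp: ab sets_borel)
    qed
    \<comment> \<open>An enumeration without repetitions, so that the interiors form a disjoint family.\<close>
    define f where "f k = (if k \<in> to_nat_on \<D> ` \<D> then from_nat_into \<D> k else {})" for k
    have f_cases: "f k \<in> \<D> \<or> f k = {}" for k by (auto simp: f_def \<D>(1))
    have f_onto: "\<exists>k. f k = D" if "D \<in> \<D>" for D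
      using that \<D>(1) by (intro exI[of _ "to_nat_on \<D> D"]) (auto simp: f_def)
    have disj: "disjoint_family (\<lambda>k. interior (f k))"
      unfolding disjoint_family_on_def
    proof (intro ballI impI)
      fix k l :: nat assume "k \<noteq> l"
      show "interior (f k) \<inter> interior (f l) = {}"
      proof (cases "k \<in> to_nat_on \<D> ` \<D> \<and> l \<in> to_nat_on \<D> ` \<D>")
        case True
        then obtain D E where DE: "D \<in> \<D>" "E \<in> \<D>" "k = to_nat_on \<D> D" "l = to_nat_on \<D> E" by auto
        then have "f k = D" "f l = E" "D \<noteq> E" using \<D>(1) \<open>k \<noteq> l\<close> by (auto simp: f_def)
        then show ?thesis using \<D>(3) DE by (auto simp: pairwise_def)
      qed (auto simp: f_def)
    qed
    have fsets: "range f \<subseteq> sets \<mu>" using f_cases piece by (metis empty_iff image_subset_iff sets.empty_sets)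
    have "A \<subseteq> (\<Union>k. f k)" using \<D>(5) f_onto by blast
    then have "emeasure \<mu> A \<le> emeasure \<mu> (\<Union>k. f k)" using fsets by (intro emeasure_mono) auto
    also have "\<dots> \<le> suminf (\<lambda>k. emeasure \<mu> (f k))" by (rule emeasure_subadditive_countably[OF fsets])
    also have "\<dots> \<le> suminf (\<lambda>k. ennreal (C / r) * emeasure lborel (interior (f k)))"
    proof (intro suminf_le)
      show "emeasure \<mu> (f k) \<le> ennreal (C / r) * emeasure lborel (interior (f k))" for k
        using f_cases[of k] piece by auto
    qed auto
    also have "\<dots> = ennreal (C / r) * emeasure lborel (\<Union>k. interior (f k))"
      unfolding ennreal_suminf_cmult by (subst suminf_emeasure[OF _ disj]) auto
    also have "\<dots> \<le> ennreal (C / r) * emeasure lborel U"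
      using f_cases piece U(1) by (intro mult_left_mono emeasure_mono) (fastforce simp: borel_open)+
    also have "\<dots> \<le> ennreal (C / r) * ennreal \<epsilon>" using U_le by (intro mult_left_mono) auto
    finally show ?thesis .
  qed
  have "measure \<mu> A \<le> 0"
  proof (rule field_le_epsilon)
    fix \<eta> :: real assume \<eta>: "0 < \<eta>"
    define \<epsilon> where "\<epsilon> = \<eta> / (C / r + 1)"
    have pos: "0 < C / r + 1" using C r by (simp add: add_nonneg_pos)
    have \<epsilon>: "0 < \<epsilon>" using \<eta> pos by (simp add: \<epsilon>_def)
    have "ennreal (C / r) * ennreal \<epsilon> = ennreal (C / r * \<epsilon>)"
      by (rule ennreal_mult[symmetric]) (use C r \<epsilon> in auto)
    then have "ennreal (measure \<mu> A) \<le> ennreal (C / r * \<epsilon>)"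
      using small[OF \<epsilon>] by (simp only: emeasure_eq_measure)
    moreover have "0 \<le> C / r * \<epsilon>" using C r \<epsilon> by simp
    ultimately have "measure \<mu> A \<le> C / r * \<epsilon>" using ennreal_le_iff by blast
    also have "\<dots> \<le> (C / r + 1) * \<epsilon>" using \<epsilon> by (simp add: algebra_simps)
    also have "\<dots> = \<eta>" using pos by (simp add: \<epsilon>_def)
    finally show "measure \<mu> A \<le> 0 + \<eta>" by simp
  qed
  then have "emeasure \<mu> A = 0" by (simp add: emeasure_eq_measure measure_le_0_iff)
  then show ?thesis using A_borel by (simp add: null_sets_def sets_borel)
qed

text \<open>The bounds on intervals degenerate as \<open>r\<close> tends to \<open>0\<close>, which is why the point \<open>0\<close> is treated apart.\<close>

lemma absolutely_continuousI:
  assumes zero: "measure \<mu> {0} = 0" and C: "0 \<le> C"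
    and bound: "\<And>\<sigma> r a b. \<sigma> = 1 \<or> \<sigma> = -1 \<Longrightarrow> 0 < r \<Longrightarrow> a < b \<Longrightarrow> (\<And>t. t \<in> {a..b} \<Longrightarrow> r \<le> \<sigma> * t) \<Longrightarrow>
      r * measure \<mu> {a..b} \<le> C * (b - a)"
  shows "absolutely_continuous lborel \<mu>"
  unfolding absolutely_continuous_def
proof
  fix N :: "real set" assume N: "N \<in> null_sets lborel"
  define part where "part \<sigma> k = N \<inter> {t. 2 * (1 / real (Suc k)) \<le> \<sigma> * t \<and> \<bar>t\<bar> \<le> real (Suc k)}" for \<sigma> k
  have part: "part \<sigma> k \<in> null_sets \<mu>" if \<sigma>: "\<sigma> = 1 \<or> \<sigma> = -1" for \<sigma> k
  proof (rule null_away_from_zero[of "1 / real (Suc k)" \<sigma> C _ "real (Suc k)", OF _ C _ \<sigma>])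
    show "part \<sigma> k \<in> null_sets lborel"
      unfolding part_def by (rule null_set_Int2[OF N]) measurable
    show "1 / real (Suc k) * measure \<mu> {a..b} \<le> C * (b - a)"
      if "a < b" "\<And>t. t \<in> {a..b} \<Longrightarrow> 1 / real (Suc k) \<le> \<sigma> * t" for a b
      by (rule bound[OF \<sigma> _ that]) simp_all
  qed (auto simp: part_def)
  have "N \<subseteq> {0} \<union> (\<Union>k. part 1 k) \<union> (\<Union>k. part (-1) k)"
  proof
    fix t assume t: "t \<in> N"
    show "t \<in> {0} \<union> (\<Union>k. part 1 k) \<union> (\<Union>k. part (-1) k)"
    proof (cases "t = 0")
      case False
      obtain k where k: "\<bar>t\<bar> + 2 / \<bar>t\<bar> \<le> real k" using real_arch_simple by blast
      have "0 \<le> 2 / \<bar>t\<bar>" by simp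
      then have 1: "\<bar>t\<bar> \<le> real (Suc k)" and "2 / \<bar>t\<bar> \<le> real (Suc k)" using k by linarith+
      then have 2: "2 * (1 / real (Suc k)) \<le> \<bar>t\<bar>" using False by (simp add: field_simps)
      show ?thesis
      proof (cases "t > 0")
        case True
        then have "t \<in> part 1 k" unfolding part_def using t 1 2 by simp
        then show ?thesis by blast
      next
        case neg: False
        then have "t \<in> part (-1) k" unfolding part_def using t 1 2 by simp
        then show ?thesis by blast
      qed
    qed simp
  qed
  moreover have "{0} \<in> null_sets \<mu>"
    using zero by (simp add: null_sets_def sets_borel emeasure_eq_measure)
  then have "{0} \<union> (\<Union>k. part 1 k) \<union> (\<Union>k. part (-1) k) \<in> null_sets \<mu>"
    by (intro null_sets.Un null_sets_UN part) auto
  moreover have "N \<in> sets \<mu>" using N by (auto simp: null_sets_def sets_borel)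
  ultimately show "N \<in> null_sets \<mu>" by (auto intro: null_sets_subset)
qed

end


section \<open>The left regular representation\<close>

lemma
  assumes "\<And>A. A \<in> S \<Longrightarrow> bounded_clinear A"
  shows commutant_id: "id \<in> commutant S"
    and commutant_add: "A \<in> commutant S \<Longrightarrow> B \<in> commutant S \<Longrightarrow> (\<lambda>v. A v + B v) \<in> commutant S"
    and commutant_scaleC: "A \<in> commutant S \<Longrightarrow> (\<lambda>v. c *\<^sub>C A v) \<in> commutant S"
    and commutant_comp: "A \<in> commutant S \<Longrightarrow> B \<in> commutant S \<Longrightarrow> A \<circ> B \<in> commutant S"
proof -
  show "id \<in> commutant S" by (simp add: commutant_def bounded_clinear_id)
next
  assume AB: "A \<in> commutant S" "B \<in> commutant S"
  show "(\<lambda>v. A v + B v) \<in> commutant S"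
    unfolding commutant_def mem_Collect_eq
  proof (intro conjI ballI ext)
    show "bounded_clinear (\<lambda>v. A v + B v)" using AB by (simp add: commutant_def bounded_clinear_plus)
    fix C v assume C: "C \<in> S"
    then have "A (C v) = C (A v)" "B (C v) = C (B v)"
      using AB unfolding commutant_def by (auto dest: comp_eq_dest)
    then show "((\<lambda>v. A v + B v) \<circ> C) v = (C \<circ> (\<lambda>v. A v + B v)) v"
      by (simp add: bounded_clinear_add[OF assms[OF C]])
  qed
  show "A \<circ> B \<in> commutant S"
    using AB unfolding commutant_def mem_Collect_eq by (metis bounded_clinear_comp comp_assoc)
next
  assume A: "A \<in> commutant S"
  show "(\<lambda>v. c *\<^sub>C A v) \<in> commutant S"
    unfolding commutant_def mem_Collect_eq
  proof (intro conjI ballI ext)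
    show "bounded_clinear (\<lambda>v. c *\<^sub>C A v)"
      using A by (simp add: commutant_def bounded_clinear_const_scaleC)
    fix C v assume C: "C \<in> S"
    then have "A (C v) = C (A v)"
      using A unfolding commutant_def by (auto dest: comp_eq_dest)
    then show "((\<lambda>v. c *\<^sub>C A v) \<circ> C) v = (C \<circ> (\<lambda>v. c *\<^sub>C A v)) v"
      by (simp add: bounded_clinear_scaleC[OF assms[OF C]])
  qed
qed

locale standard_form =
  fixes M :: "'k::chilbert_space operator set" and \<tau> :: "'k operator \<Rightarrow> complex"
    and \<Lambda> :: "'k operator \<Rightarrow> 'h::chilbert_space" and \<pi> :: "'k operator \<Rightarrow> 'h operator"
  assumes tvna: "tracial_von_neumann_algebra M \<tau>" and L2: "L2_representation M \<tau> \<Lambda> \<pi>"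
begin

lemma M_bounded: "A \<in> M \<Longrightarrow> bounded_clinear A"
  and M_adjoint: "A \<in> M \<Longrightarrow> cadjoint A \<in> M"
  and M_bicommutant: "commutant (commutant M) = M"
  using tvna by (auto simp: tracial_von_neumann_algebra_def von_neumann_algebra_def)

lemma commutant_M_bounded: "A \<in> commutant M \<Longrightarrow> bounded_clinear A"
  by (simp add: commutant_def)

lemma M_id: "id \<in> M"
  and M_add: "A \<in> M \<Longrightarrow> B \<in> M \<Longrightarrow> (\<lambda>v. A v + B v) \<in> M"
  and M_scaleC: "A \<in> M \<Longrightarrow> (\<lambda>v. c *\<^sub>C A v) \<in> M"
  and M_comp: "A \<in> M \<Longrightarrow> B \<in> M \<Longrightarrow> A \<circ> B \<in> M"
  using commutant_id[of "commutant M"] commutant_add[of "commutant M" A B]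
    commutant_scaleC[of "commutant M" A] commutant_comp[of "commutant M" A B] commutant_M_bounded
  unfolding M_bicommutant by blast+

lemma M_zero: "(\<lambda>v. 0) \<in> M"
  using M_scaleC[OF M_id, of 0] by simp

lemma tau_id: "\<tau> id = 1" and tau_commute: "A \<in> M \<Longrightarrow> B \<in> M \<Longrightarrow> \<tau> (A \<circ> B) = \<tau> (B \<circ> A)"
  using tvna by (simp_all add: tracial_von_neumann_algebra_def faithful_normal_tracial_state_def)

lemma \<Lambda>_add: "A \<in> M \<Longrightarrow> B \<in> M \<Longrightarrow> \<Lambda> (\<lambda>v. A v + B v) = \<Lambda> A + \<Lambda> B"
  and \<Lambda>_scaleC: "A \<in> M \<Longrightarrow> \<Lambda> (\<lambda>v. c *\<^sub>C A v) = c *\<^sub>C \<Lambda> A"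
  and \<Lambda>_cinner: "A \<in> M \<Longrightarrow> B \<in> M \<Longrightarrow> cinner (\<Lambda> A) (\<Lambda> B) = \<tau> (cadjoint A \<circ> B)"
  and \<Lambda>_dense: "closure (\<Lambda> ` M) = UNIV"
  and \<pi>_bounded: "A \<in> M \<Longrightarrow> bounded_clinear (\<pi> A)"
  and \<pi>_\<Lambda>: "A \<in> M \<Longrightarrow> B \<in> M \<Longrightarrow> \<pi> A (\<Lambda> B) = \<Lambda> (A \<circ> B)"
  using L2 by (simp_all add: L2_representation_def)

lemma eq_on_\<Lambda>:
  assumes "bounded_clinear f" "bounded_clinear g" "\<And>A. A \<in> M \<Longrightarrow> f (\<Lambda> A) = g (\<Lambda> A)"
  shows "f = (g :: 'h operator)"
  by (rule bounded_clinear_eq_on_dense[OF assms(1,2) \<Lambda>_dense]) (use assms(3) in auto)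

lemma \<pi>_id: "\<pi> id = id"
  by (rule eq_on_\<Lambda>) (simp_all add: \<pi>_bounded M_id bounded_clinear_id \<pi>_\<Lambda>)

lemma \<pi>_add: "A \<in> M \<Longrightarrow> B \<in> M \<Longrightarrow> \<pi> (\<lambda>v. A v + B v) = (\<lambda>v. \<pi> A v + \<pi> B v)"
  using \<Lambda>_add[OF M_comp M_comp, of A _ B]
  by (intro eq_on_\<Lambda>) (simp_all add: \<pi>_bounded M_add bounded_clinear_plus \<pi>_\<Lambda> comp_def)

lemma \<pi>_scaleC: "A \<in> M \<Longrightarrow> \<pi> (\<lambda>v. c *\<^sub>C A v) = (\<lambda>v. c *\<^sub>C \<pi> A v)"
  using \<Lambda>_scaleC[OF M_comp, of A]
  by (intro eq_on_\<Lambda>) (simp_all add: \<pi>_bounded M_scaleC bounded_clinear_const_scaleC \<pi>_\<Lambda> comp_def)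

lemma \<pi>_comp: "A \<in> M \<Longrightarrow> B \<in> M \<Longrightarrow> \<pi> (A \<circ> B) = \<pi> A \<circ> \<pi> B"
  by (intro eq_on_\<Lambda>) (simp_all add: \<pi>_bounded M_comp bounded_clinear_comp \<pi>_\<Lambda> comp_assoc)

lemma \<pi>_cadjoint:
  assumes A: "A \<in> M" shows "cadjoint (\<pi> A) = \<pi> (cadjoint A)"
proof (rule cadjoint_unique)
  fix u v
  show "cinner (\<pi> A u) v = cinner u (\<pi> (cadjoint A) v)"
  proof (rule cinner_eq_on_dense[OF \<pi>_bounded[OF A] \<pi>_bounded[OF M_adjoint[OF A]] \<Lambda>_dense])
    fix s t assume "s \<in> \<Lambda> ` M" "t \<in> \<Lambda> ` M"
    then obtain B C where "B \<in> M" "C \<in> M" "s = \<Lambda> B" "t = \<Lambda> C" by blast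
    then show "cinner (\<pi> A s) t = cinner s (\<pi> (cadjoint A) t)"
      by (simp add: A \<pi>_\<Lambda> \<Lambda>_cinner M_comp M_adjoint M_bounded cadjoint_comp comp_assoc)
  qed
qed

lemma norm_\<Lambda>: "A \<in> M \<Longrightarrow> complex_of_real ((norm (\<Lambda> A))\<^sup>2) = \<tau> (cadjoint A \<circ> A)"
  using cinner_self[of "\<Lambda> A"] by (simp add: \<Lambda>_cinner)

lemma norm_\<Lambda>_cadjoint:
  assumes A: "A \<in> M" shows "norm (\<Lambda> (cadjoint A)) = norm (\<Lambda> A)"
proof -
  have "complex_of_real ((norm (\<Lambda> (cadjoint A)))\<^sup>2) = complex_of_real ((norm (\<Lambda> A))\<^sup>2)"
    unfolding norm_\<Lambda>[OF A] norm_\<Lambda>[OF M_adjoint[OF A]] cadjoint_cadjoint[OF M_bounded[OF A]]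
    by (rule tau_commute[OF A M_adjoint[OF A]])
  then have "(norm (\<Lambda> (cadjoint A)))\<^sup>2 = (norm (\<Lambda> A))\<^sup>2" using of_real_eq_iff by blast
  then show ?thesis by (simp add: power2_eq_iff_nonneg)
qed

text \<open>Right multiplication by \<open>B\<close> is bounded because it is conjugate, under the isometry \<open>A \<mapsto> A\<^sup>*\<close>, to the
  left multiplication by \<open>B\<^sup>*\<close>.\<close>

lemma right_multiplication:
  assumes B: "B \<in> M"
  obtains Q where "Q \<in> commutant (\<pi> ` M)" "\<And>A. A \<in> M \<Longrightarrow> Q (\<Lambda> A) = \<Lambda> (A \<circ> B)"
proof -
  obtain K where K: "\<And>v. norm (\<pi> (cadjoint B) v) \<le> K * norm v"
    using bounded_clinear_bound[OF \<pi>_bounded[OF M_adjoint[OF B]]] by metis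
  have bound: "norm (\<Lambda> (A \<circ> B)) \<le> K * norm (\<Lambda> A)" if A: "A \<in> M" for A
  proof -
    have "norm (\<Lambda> (A \<circ> B)) = norm (\<pi> (cadjoint B) (\<Lambda> (cadjoint A)))"
      using norm_\<Lambda>_cadjoint[OF M_comp[OF A B]]
      by (simp add: \<pi>_\<Lambda> M_adjoint A B cadjoint_comp M_bounded)
    also have "\<dots> \<le> K * norm (\<Lambda> (cadjoint A))" by (rule K)
    finally show ?thesis by (simp add: norm_\<Lambda>_cadjoint[OF A])
  qed
  have add: "\<Lambda> ((\<lambda>v. A v + A' v) \<circ> B) = \<Lambda> (A \<circ> B) + \<Lambda> (A' \<circ> B)" if "A \<in> M" "A' \<in> M" for A A'
    using \<Lambda>_add[OF M_comp[OF that(1) B] M_comp[OF that(2) B]] by (simp add: comp_def)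
  have scale: "\<Lambda> ((\<lambda>v. c *\<^sub>C A v) \<circ> B) = c *\<^sub>C \<Lambda> (A \<circ> B)" if "A \<in> M" for A c
    using \<Lambda>_scaleC[OF M_comp[OF that B]] by (simp add: comp_def)
  have well_defined: "\<Lambda> (A \<circ> B) = \<Lambda> (A' \<circ> B)" if A: "A \<in> M" "A' \<in> M" and eq: "\<Lambda> A = \<Lambda> A'" for A A'
  proof -
    let ?D = "\<lambda>v. A v + (-1) *\<^sub>C A' v"
    have D: "?D \<in> M" by (intro M_add M_scaleC A)
    have "\<Lambda> ?D = \<Lambda> A + (-1) *\<^sub>C \<Lambda> A'"
      unfolding \<Lambda>_add[OF A(1) M_scaleC[OF A(2)]] \<Lambda>_scaleC[OF A(2)] ..
    then have "\<Lambda> ?D = 0" by (simp only: eq scaleC_minus_left scaleC_1 right_minus)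
    then have "\<Lambda> (?D \<circ> B) = 0" using bound[OF D] by simp
    moreover have "\<Lambda> (?D \<circ> B) = \<Lambda> (A \<circ> B) - \<Lambda> (A' \<circ> B)"
      using add[OF A(1) M_scaleC[OF A(2)], of "-1"] scale[OF A(2), of "-1"]
      by (simp add: scaleC_minus_left)
    ultimately show ?thesis by simp
  qed
  define g where "g s = \<Lambda> (inv_into M \<Lambda> s \<circ> B)" for s
  have g: "g (\<Lambda> A) = \<Lambda> (A \<circ> B)" if A: "A \<in> M" for A
    unfolding g_def
  proof (rule well_defined)
    show "inv_into M \<Lambda> (\<Lambda> A) \<in> M" by (rule inv_into_into[OF imageI[OF A]])
    show "\<Lambda> (inv_into M \<Lambda> (\<Lambda> A)) = \<Lambda> A" by (rule f_inv_into_f[of "\<Lambda> A" \<Lambda> M, OF imageI[OF A]])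
  qed (rule A)
  obtain Q where bQ: "bounded_clinear Q" and Qg: "\<And>s. s \<in> \<Lambda> ` M \<Longrightarrow> Q s = g s"
  proof (rule bounded_clinear_extension[OF \<Lambda>_dense, of g K])
    fix s t :: 'h and c :: complex
    assume "s \<in> \<Lambda> ` M" then obtain A where A: "A \<in> M" "s = \<Lambda> A" by blast
    show "c *\<^sub>C s \<in> \<Lambda> ` M"
      using A imageI[OF M_scaleC[OF A(1)], of \<Lambda>] by (simp add: \<Lambda>_scaleC)
    show "g (c *\<^sub>C s) = c *\<^sub>C g s"
      using A g[OF M_scaleC[OF A(1)]] by (simp add: \<Lambda>_scaleC scale g)
    show "norm (g s) \<le> K * norm s" using A bound g by simp
    assume "t \<in> \<Lambda> ` M" then obtain A' where A': "A' \<in> M" "t = \<Lambda> A'" by blast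
    show "s + t \<in> \<Lambda> ` M"
      using A A' imageI[OF M_add[OF A(1) A'(1)], of \<Lambda>] by (simp add: \<Lambda>_add)
    show "g (s + t) = g s + g t"
      using A A' g[OF M_add[OF A(1) A'(1)]] by (simp add: \<Lambda>_add add g)
  qed blast
  have Q\<Lambda>: "Q (\<Lambda> A) = \<Lambda> (A \<circ> B)" if "A \<in> M" for A using Qg g that by simp
  have "Q \<circ> \<pi> A = \<pi> A \<circ> Q" if A: "A \<in> M" for A
    by (rule eq_on_\<Lambda>) (simp_all add: bounded_clinear_comp bQ \<pi>_bounded A Q\<Lambda> \<pi>_\<Lambda> M_comp B comp_assoc)
  then have "Q \<in> commutant (\<pi> ` M)" using bQ by (simp add: commutant_def)
  then show thesis by (rule that) (rule Q\<Lambda>)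
qed

sublocale tracial_algebra "\<pi> ` M" "\<Lambda> id"
proof
  have vec: "\<pi> A (\<Lambda> id) = \<Lambda> A" if "A \<in> M" for A using that by (simp add: \<pi>_\<Lambda> M_id)
  have cadjoint_id: "cadjoint id = (id :: 'k operator)" by (rule cadjoint_unique) simp
  show "id \<in> \<pi> ` M" using \<pi>_id M_id by (metis imageI)
  show "norm (\<Lambda> id) = 1"
    using norm_\<Lambda>[OF M_id] of_real_eq_1_iff[where 'a=complex, of "(norm (\<Lambda> id))\<^sup>2"]
    by (simp add: cadjoint_id tau_id power2_eq_1_iff del: of_real_power) (smt (verit) norm_ge_zero)
  fix S assume "S \<in> \<pi> ` M"
  then obtain A where A: "A \<in> M" "S = \<pi> A" by blast
  show "bounded_clinear S" using A by (simp add: \<pi>_bounded)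
  show "(\<lambda>v. c *\<^sub>C S v) \<in> \<pi> ` M" for c
    using A imageI[OF M_scaleC[OF A(1)], of \<pi>] by (simp add: \<pi>_scaleC)
  show "cadjoint S \<in> \<pi> ` M"
    using A imageI[OF M_adjoint[OF A(1)], of \<pi>] by (simp add: \<pi>_cadjoint)
  show "\<exists>Q\<in>commutant (\<pi> ` M). Q (\<Lambda> id) = S (\<Lambda> id)"
  proof -
    obtain Q where "Q \<in> commutant (\<pi> ` M)" "Q (\<Lambda> id) = \<Lambda> (id \<circ> A)"
      using right_multiplication[OF A(1)] M_id by metis
    then show ?thesis using vec[OF A(1)] A(2) by auto
  qed
  fix S' assume "S' \<in> \<pi> ` M"
  then obtain B where B: "B \<in> M" "S' = \<pi> B" by blast
  show "(\<lambda>v. S v + S' v) \<in> \<pi> ` M"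
    using A B imageI[OF M_add[OF A(1) B(1)], of \<pi>] by (simp add: \<pi>_add)
  show "S \<circ> S' \<in> \<pi> ` M"
    using A B imageI[OF M_comp[OF A(1) B(1)], of \<pi>] by (simp add: \<pi>_comp)
  show "cinner (\<Lambda> id) (S (S' (\<Lambda> id))) = cinner (\<Lambda> id) (S' (S (\<Lambda> id)))"
    using A B tau_commute[OF A(1) B(1)]
    by (simp add: vec \<pi>_\<Lambda> \<Lambda>_cinner M_id M_comp cadjoint_id)
next
  have "\<Lambda> ` M \<subseteq> {Q (\<Lambda> id) |Q. Q \<in> commutant (\<pi> ` M)}"
  proof
    fix s assume "s \<in> \<Lambda> ` M"
    then obtain B where B: "B \<in> M" "s = \<Lambda> B" by blast
    then obtain Q where "Q \<in> commutant (\<pi> ` M)" "Q (\<Lambda> id) = \<Lambda> (id \<circ> B)"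
      using right_multiplication M_id by metis
    then show "s \<in> {Q (\<Lambda> id) |Q. Q \<in> commutant (\<pi> ` M)}"
      using B by (intro CollectI exI[of _ Q]) simp
  qed
  then show "closure {Q (\<Lambda> id) |Q. Q \<in> commutant (\<pi> ` M)} = UNIV"
    using closure_mono \<Lambda>_dense by blast
qed


lemma M_funpow: "A \<in> M \<Longrightarrow> A ^^ k \<in> M"
  by (induction k) (simp_all only: funpow.simps M_id M_comp)

lemma vector_state: "A \<in> M \<Longrightarrow> cinner (\<Lambda> id) ((\<pi> A ^^ k) (\<Lambda> id)) = \<tau> (A ^^ k)"
proof -
  assume A: "A \<in> M"
  have "(\<pi> A ^^ k) (\<Lambda> id) = \<Lambda> (A ^^ k)"
  proof (induction k)
    case (Suc k)
    have "(\<pi> A ^^ Suc k) (\<Lambda> id) = \<pi> A (\<Lambda> (A ^^ k))" by (simp add: Suc)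
    also have "\<dots> = \<Lambda> (A ^^ Suc k)" unfolding funpow.simps by (rule \<pi>_\<Lambda>[OF A M_funpow[OF A]])
    finally show ?case .
  qed simp
  moreover have "cadjoint id = (id :: 'k operator)" by (rule cadjoint_unique) simp
  ultimately show ?thesis using A by (simp add: \<Lambda>_cinner M_id M_funpow)
qed

end


section \<open>Non-commutative polynomials\<close>

lemma nc_eval_eq_sum:
  assumes "finite W" "Poly_Mapping.keys p \<subseteq> W"
  shows "nc_eval y p v = (\<Sum>w\<in>W. Poly_Mapping.lookup p w *\<^sub>C nc_monomial y w v)"
  unfolding nc_eval_def
  by (rule sum.mono_neutral_left) (use assms in \<open>auto simp: in_keys_iff\<close>)

lemma finite_subset_words:
  assumes W: "finite W" and letters: "\<And>w. w \<in> W \<Longrightarrow> set w \<subseteq> {1..m}"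
  shows "\<exists>d. W \<subseteq> words m (Suc d)"
proof -
  obtain d where "\<And>w. w \<in> W \<Longrightarrow> length w \<le> d"
    using finite_nat_set_iff_bounded_le[of "length ` W"] W by auto
  then have "w \<in> words m (Suc d)" if "w \<in> W" for w
    using letters[OF that] that by (simp add: words_def le_SucI)
  then show ?thesis by blast
qed

lemma lookup_nc_number:
  "Poly_Mapping.lookup (nc_number j p) w = of_nat (count_list w j) * Poly_Mapping.lookup p w"
  by (simp add: nc_number_def lookup_mapp in_keys_iff when_def)

lemma keys_nc_number: "Poly_Mapping.keys (nc_number j p) \<subseteq> Poly_Mapping.keys p"
  by (auto simp: in_keys_iff lookup_nc_number)

lemma nc_eval_add: "nc_eval y (p + q) v = nc_eval y p v + nc_eval y q v"
proof -
  let ?W = "Poly_Mapping.keys p \<union> Poly_Mapping.keys q"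
  have "finite ?W" "Poly_Mapping.keys (p + q) \<subseteq> ?W" by (auto simp: keys_add)
  then show ?thesis
    by (simp add: nc_eval_eq_sum[of ?W] lookup_add scaleC_add_left sum.distrib)
qed

lemma nc_eval_scaleC:
  "nc_eval y (Poly_Mapping.mapp (\<lambda>_ x. c * x) p) v = c *\<^sub>C nc_eval y p v"
proof -
  have l: "Poly_Mapping.lookup (Poly_Mapping.mapp (\<lambda>_ x. c * x) p) w = c * Poly_Mapping.lookup p w" for w
    by (simp add: lookup_mapp in_keys_iff when_def)
  then have "Poly_Mapping.keys (Poly_Mapping.mapp (\<lambda>_ x. c * x) p) \<subseteq> Poly_Mapping.keys p"
    by (auto simp: in_keys_iff)
  then show ?thesis
    by (simp add: nc_eval_eq_sum[of "Poly_Mapping.keys p"] l scaleC_sum_right scaleC_scaleC)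
qed

lemma Alg_eq_nc_eval:
  assumes y: "\<And>j. j \<in> J \<Longrightarrow> bounded_clinear (y j)" and A: "A \<in> Alg (y ` J)"
  obtains p where "p \<in> ncpolys J" "A = nc_eval y p"
proof -
  define P where "P = nc_eval y ` ncpolys J"
  have P_add: "(\<lambda>v. A v + B v) \<in> P" if AB: "A \<in> P" "B \<in> P" for A B
  proof -
    obtain p q where pq: "p \<in> ncpolys J" "A = nc_eval y p" "q \<in> ncpolys J" "B = nc_eval y q"
      using AB unfolding P_def by blast
    then have "p + q \<in> ncpolys J" using keys_add[of p q] by (auto simp: ncpolys_def)
    moreover have "(\<lambda>v. A v + B v) = nc_eval y (p + q)" by (rule ext) (simp add: pq nc_eval_add)
    ultimately show ?thesis unfolding P_def by blast
  qed
  have P_scale: "(\<lambda>v. c *\<^sub>C A v) \<in> P" if A: "A \<in> P" for A c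
  proof -
    obtain p where p: "p \<in> ncpolys J" "A = nc_eval y p" using A unfolding P_def by blast
    then have "Poly_Mapping.mapp (\<lambda>_ x. c * x) p \<in> ncpolys J"
      by (auto simp: ncpolys_def in_keys_iff lookup_mapp when_def split: if_splits)
    moreover have "(\<lambda>v. c *\<^sub>C A v) = nc_eval y (Poly_Mapping.mapp (\<lambda>_ x. c * x) p)"
      by (rule ext) (simp add: p nc_eval_scaleC)
    ultimately show ?thesis unfolding P_def by blast
  qed
  have "0 \<in> ncpolys J" "(\<lambda>v. 0) = nc_eval y 0" by (auto simp: ncpolys_def nc_eval_def)
  then have P_zero: "(\<lambda>v. 0) \<in> P" unfolding P_def by blast
  have P_sum: "(\<lambda>v. \<Sum>i\<in>I. F i v) \<in> P" if "\<And>i. i \<in> I \<Longrightarrow> F i \<in> P" for I :: "nat list set" and F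
    using that by (induction I rule: infinite_finite_induct) (auto simp: P_zero P_add)
  have P_mon: "nc_monomial y w \<in> P" if "set w \<subseteq> J" for w
  proof -
    have "Poly_Mapping.single w 1 \<in> ncpolys J" using that by (auto simp: ncpolys_def)
    moreover have "nc_monomial y w = nc_eval y (Poly_Mapping.single w 1)"
      by (rule ext) (simp add: nc_eval_def)
    ultimately show ?thesis unfolding P_def by blast
  qed
  have mon_bounded: "bounded_clinear (nc_monomial y w)" if "set w \<subseteq> J" for w
    using that by (induction w) (simp_all only: nc_monomial_Nil nc_monomial_Cons bounded_clinear_id
        bounded_clinear_comp y list.set insert_subset)
  have P_comp: "A \<circ> B \<in> P" if AB: "A \<in> P" "B \<in> P" for A B
  proof -
    obtain p q where pq: "p \<in> ncpolys J" "A = nc_eval y p" "q \<in> ncpolys J" "B = nc_eval y q"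
      using AB unfolding P_def by blast
    have keys: "set u \<subseteq> J" if "u \<in> Poly_Mapping.keys p \<union> Poly_Mapping.keys q" for u
      using pq that by (auto simp: ncpolys_def)
    have "A \<circ> B = (\<lambda>v. \<Sum>u\<in>Poly_Mapping.keys p. Poly_Mapping.lookup p u *\<^sub>C
        (\<Sum>w\<in>Poly_Mapping.keys q. Poly_Mapping.lookup q w *\<^sub>C nc_monomial y (u @ w) v))"
    proof
      fix v
      have "nc_monomial y u (B v)
          = (\<Sum>w\<in>Poly_Mapping.keys q. Poly_Mapping.lookup q w *\<^sub>C nc_monomial y (u @ w) v)"
        if "u \<in> Poly_Mapping.keys p" for u
        unfolding pq(4) nc_eval_def
        using mon_bounded[OF keys, of u] that
        by (simp add: bounded_clinear_sum bounded_clinear_scaleC nc_monomial_append)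
      then show "(A \<circ> B) v = (\<Sum>u\<in>Poly_Mapping.keys p. Poly_Mapping.lookup p u *\<^sub>C
          (\<Sum>w\<in>Poly_Mapping.keys q. Poly_Mapping.lookup q w *\<^sub>C nc_monomial y (u @ w) v))"
        by (simp add: pq(2) nc_eval_def)
    qed
    also have "\<dots> \<in> P" using keys by (intro P_sum P_scale P_mon) auto
    finally show ?thesis .
  qed
  have "A \<in> P"
    using A
  proof induction
    case Alg_one
    have "nc_monomial y [] \<in> P" by (rule P_mon) simp
    then show ?case unfolding nc_monomial_Nil .
  next
    case (Alg_gen A)
    then obtain j where "j \<in> J" "A = y j" by blast
    then show ?case using P_mon[of "[j]"] by (simp add: nc_monomial_Nil nc_monomial_Cons)
  qed (rule P_add P_scale P_comp, assumption+)+
  then show thesis using that by (auto simp: P_def)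
qed

context standard_form
begin

lemma M_monomial:
  assumes "\<And>j. j \<in> J \<Longrightarrow> y j \<in> M" "set w \<subseteq> J"
  shows "nc_monomial y w \<in> M" and "\<pi> (nc_monomial y w) = nc_monomial (\<lambda>j. \<pi> (y j)) w"
proof -
  have "nc_monomial y w \<in> M \<and> \<pi> (nc_monomial y w) = nc_monomial (\<lambda>j. \<pi> (y j)) w"
    using assms(2) by (induction w)
      (simp_all add: nc_monomial_Nil nc_monomial_Cons M_id M_comp \<pi>_id \<pi>_comp assms(1))
  then show "nc_monomial y w \<in> M" "\<pi> (nc_monomial y w) = nc_monomial (\<lambda>j. \<pi> (y j)) w" by simp_all
qed

lemma
  assumes y: "\<And>j. j \<in> J \<Longrightarrow> y j \<in> M" and p: "p \<in> ncpolys J"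
  shows nc_eval_mem: "nc_eval y p \<in> M" and \<pi>_nc_eval: "\<pi> (nc_eval y p) = nc_eval (\<lambda>j. \<pi> (y j)) p"
proof -
  have "(\<lambda>v. \<Sum>w\<in>W. c w *\<^sub>C nc_monomial y w v) \<in> M \<and>
      \<pi> (\<lambda>v. \<Sum>w\<in>W. c w *\<^sub>C nc_monomial y w v) = (\<lambda>v. \<Sum>w\<in>W. c w *\<^sub>C nc_monomial (\<lambda>j. \<pi> (y j)) w v)"
    if "finite W" "\<And>w. w \<in> W \<Longrightarrow> set w \<subseteq> J" for W and c :: "nat list \<Rightarrow> complex"
    using that
  proof (induction W)
    case empty
    then show ?case using \<pi>_scaleC[OF M_id, of 0] by (simp add: M_zero)
  next
    case (insert w W)
    then have "set w \<subseteq> J" by simp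
    note mon = M_monomial[of J y, OF y this]
    show ?case using insert mon
      by (simp add: M_add M_scaleC \<pi>_add \<pi>_scaleC)
  qed
  from this[of "Poly_Mapping.keys p" "Poly_Mapping.lookup p"] p
  show "nc_eval y p \<in> M" "\<pi> (nc_eval y p) = nc_eval (\<lambda>j. \<pi> (y j)) p"
    unfolding nc_eval_def by (simp_all add: ncpolys_def)
qed

end


section \<open>Eigenvectors of the number operators\<close>

context distributed_polynomial
begin

text \<open>Since a polynomial that vanishes as an operator has zero coefficients, the eigenvalue of the number operator
  is the number of occurrences of \<open>j\<close> in any word of \<open>T\<close>. Here \<open>j\<close> is the first letter of such a word,
  so that the eigenvalue is nonzero and can be divided out of the commutator estimate.\<close>

lemma distribution_absolutely_continuous:
  assumes w: "w \<noteq> []" "c w \<noteq> 0"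
    and eigen: "\<And>j. j \<in> {1..m} \<Longrightarrow>
      \<exists>l. \<forall>v. word_sum (Suc d) (\<lambda>u. of_nat (count_list u j) * c u) v = l *\<^sub>C T v"
  shows "absolutely_continuous lborel \<mu>"
proof -
  have "w \<in> words m (Suc d)" using coeff_support w by blast
  then have j: "hd w \<in> {1..m}" using w(1) by (cases w) (auto simp: words_def)
  define j where "j = hd w"
  obtain l where l: "\<And>v. word_sum (Suc d) (\<lambda>u. of_nat (count_list u j) * c u) v = l *\<^sub>C T v"
    using eigen[OF j] by (auto simp: j_def)
  have "of_nat (count_list w j) * c w - l * c w = 0"
  proof (rule polynomial_kernel_trivial[of "Suc d" "\<lambda>u. of_nat (count_list u j) * c u - l * c u" e])
    show "word_sum (Suc d) (\<lambda>u. of_nat (count_list u j) * c u - l * c u) e = 0"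
      using l[of e] unfolding T_eq word_sum_def
      by (simp add: scaleC_diff_left sum_subtractf scaleC_sum_right scaleC_scaleC)
    show "e \<noteq> 0" using norm_e by auto
  qed (simp add: coeff_support)
  then have "l = of_nat (count_list w j)" using w(2) by simp
  moreover have "count_list w j \<noteq> 0" using w(1) by (cases w) (auto simp: j_def)
  ultimately have l0: "cmod l > 0" by simp
  obtain C where C: "0 \<le> C"
    "\<forall>p s B B'. (\<forall>t\<in>K. \<bar>poly p t\<bar> \<le> B) \<and> (\<forall>t\<in>K. \<bar>(t - s) * poly p t\<bar> \<le> B') \<longrightarrow>
      cmod l * \<bar>\<integral>t. (poly p t)\<^sup>2 * t \<partial>\<mu>\<bar> \<le> C * B * B'"
    using commutator_estimate[OF j[folded j_def] l] by blast
  have est: "\<bar>\<integral>t. (poly p t)\<^sup>2 * t \<partial>\<mu>\<bar> \<le> C / cmod l * B * B'"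
    if "\<forall>t\<in>K. \<bar>poly p t\<bar> \<le> B" "\<forall>t\<in>K. \<bar>(t - s) * poly p t\<bar> \<le> B'" for p s B B'
    using C(2)[rule_format, OF conjI[OF that]] l0 by (simp add: field_simps)
  have C': "0 \<le> C / cmod l" using C(1) by simp
  show ?thesis
  proof (rule absolutely_continuousI)
    show "measure \<mu> {0} = 0"
    proof (rule no_atom_at_zero, rule ccontr)
      fix v assume "T v = 0" "v \<noteq> 0"
      then have "c w = 0" using polynomial_kernel_trivial[of "Suc d" c v w] coeff_support T_eq by blast
      with w(2) show False by simp
    qed
    show "0 \<le> 5 * (C / cmod l) + 1" using C' by simp
  next
    fix \<sigma> r a b :: real
    assume side: "\<sigma> = 1 \<or> \<sigma> = -1" "0 < r" "a < b" and away: "\<And>t. t \<in> {a..b} \<Longrightarrow> r \<le> \<sigma> * t"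
    show "r * measure \<mu> {a..b} \<le> (5 * (C / cmod l) + 1) * (b - a)"
      by (rule interval_bound[OF C' _ side]) (rule est, assumption+, rule away)
  qed
qed

end

theorem theorem13:
  fixes M :: "'k::chilbert_space operator set"
    and \<tau> :: "'k operator \<Rightarrow> complex"
    and \<Lambda> :: "'k operator \<Rightarrow> 'h::chilbert_space"
    and \<pi> :: "'k operator \<Rightarrow> 'h operator"
    and y :: "nat \<Rightarrow> 'k operator"
    and Y :: "'k operator"
    and R :: "nat \<Rightarrow> 'h operator"
    and \<mu> :: "real measure"
    and n m :: nat
  assumes "1 \<le> n" and "n \<le> m"
    and "tracial_von_neumann_algebra M \<tau>"
    and "L2_representation M \<tau> \<Lambda> \<pi>"
    and "\<forall>j\<in>{1..m}. cadjoint (y j) = y j"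
    and "M = vN_generated (y ` {1..m})"
    and "Y \<in> Alg (y ` {1..n})"
    and "cadjoint Y = Y"
    and "\<nexists>c. Y = (\<lambda>v. c *\<^sub>C v)"
    and "dual_system (\<lambda>j. \<pi> (y j)) (\<Lambda> id) m R"
    and "\<forall>j\<in>{1..m}. \<exists>c::complex. number_operator y m j Y = (\<lambda>v. c *\<^sub>C Y v)"
    and "is_spectral_measure \<tau> Y \<mu>"
  shows "absolutely_continuous lborel \<mu>"
proof -
  interpret standard_form M \<tau> \<Lambda> \<pi> by (rule standard_form.intro) (fact assms)+
  have y: "y j \<in> M" if "j \<in> {1..m}" for j
    using that assms(6) unfolding vN_generated_def by blast
  let ?x = "\<lambda>j. \<pi> (y j)"
  interpret dual_family "\<pi> ` M" "\<Lambda> id" ?x R m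
    by unfold_locales (use y assms(10) in auto)
  have "bounded_clinear (y j)" if "j \<in> {1..n}" for j using y[of j] that assms(2) by (auto intro: M_bounded)
  then obtain p where p: "p \<in> ncpolys {1..n}" and Y: "Y = nc_eval y p"
    using Alg_eq_nc_eval[OF _ assms(7)] by metis
  from p have p: "p \<in> ncpolys {1..m}" using assms(2) by (force simp: ncpolys_def)
  have YM: "Y \<in> M" unfolding Y by (rule nc_eval_mem[OF y p])
  have eval: "\<pi> (nc_eval y q) v = word_sum d (Poly_Mapping.lookup q) v"
    if "q \<in> ncpolys {1..m}" "Poly_Mapping.keys q \<subseteq> words m d" for q d v
    using \<pi>_nc_eval[OF y that(1)] nc_eval_eq_sum[OF finite_words that(2)] by (simp add: word_sum_def)
  \<comment> \<open>The generators are algebraically free, so that the number operators are well defined.\<close>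
  have eval_inj: "q = q'"
    if q: "q \<in> ncpolys {1..m}" "q' \<in> ncpolys {1..m}" and eq: "nc_eval y q = nc_eval y q'" for q q'
  proof (rule poly_mapping_eqI)
    fix w
    let ?W = "Poly_Mapping.keys q \<union> Poly_Mapping.keys q'"
    obtain d where "?W \<subseteq> words m (Suc d)"
    proof (rule exE[OF finite_subset_words])
      show "finite ?W" by simp
      show "set w \<subseteq> {1..m}" if "w \<in> ?W" for w using q that unfolding ncpolys_def by blast
    qed
    then have W: "Poly_Mapping.keys q \<subseteq> words m (Suc d)" "Poly_Mapping.keys q' \<subseteq> words m (Suc d)" by auto
    let ?c = "\<lambda>u. Poly_Mapping.lookup q u - Poly_Mapping.lookup q' u"
    have "?c w = 0"
    proof (rule polynomial_kernel_trivial[of "Suc d" ?c "\<Lambda> id"])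
      show "?c u = 0" if "u \<notin> words m (Suc d)" for u
        using W that by (metis cancel_comm_monoid_add_class.diff_cancel in_keys_iff subsetD)
      show "word_sum (Suc d) ?c (\<Lambda> id) = 0"
        using eval[OF q(1) W(1), of "\<Lambda> id"] eval[OF q(2) W(2), of "\<Lambda> id"] eq
        by (simp add: word_sum_def scaleC_diff_left sum_subtractf)
      show "\<Lambda> id \<noteq> 0" using norm_e by auto
    qed
    then show "Poly_Mapping.lookup q w = Poly_Mapping.lookup q' w" by simp
  qed
  have number_poly: "nc_number j q \<in> ncpolys {1..m}" if "q \<in> ncpolys {1..m}" for j q
    using that keys_nc_number[of j q] by (auto simp: ncpolys_def)
  have number: "number_operator y m j Y = nc_eval y (nc_number j p)" for j
    unfolding number_operator_def
  proof (rule the_equality)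
    show "\<exists>q\<in>ncpolys {1..m}. Y = nc_eval y q \<and> nc_eval y (nc_number j p) = nc_eval y (nc_number j q)"
      using p Y by blast
    fix B assume "\<exists>q\<in>ncpolys {1..m}. Y = nc_eval y q \<and> B = nc_eval y (nc_number j q)"
    then show "B = nc_eval y (nc_number j p)" using eval_inj[OF p] Y by metis
  qed
  have "\<exists>d. Poly_Mapping.keys p \<subseteq> words m (Suc d)"
    by (rule finite_subset_words) (use p in \<open>auto simp: ncpolys_def\<close>)
  then obtain d where W: "Poly_Mapping.keys p \<subseteq> words m (Suc d)" by blast
  obtain K where "prob_space \<mu>" "sets \<mu> = sets borel" "compact K" "emeasure \<mu> (- K) = 0"
    and moments: "\<And>k. complex_of_real (\<integral>t. t ^ k \<partial>\<mu>) = \<tau> (Y ^^ k)"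
    using assms(12) by (auto simp: is_spectral_measure_def)
  then interpret compactly_supported \<mu> K
    by (simp add: compactly_supported_def compactly_supported_axioms_def)
  interpret distributed_polynomial "\<pi> ` M" "\<Lambda> id" ?x R m \<mu> K "\<pi> Y" d "Poly_Mapping.lookup p"
  proof unfold_locales
    show "\<pi> Y \<in> \<pi> ` M" using YM by blast
    show "cadjoint (\<pi> Y) = \<pi> Y" using \<pi>_cadjoint[OF YM] assms(8) by simp
    show "complex_of_real (\<integral>t. t ^ k \<partial>\<mu>) = cinner (\<Lambda> id) ((\<pi> Y ^^ k) (\<Lambda> id))" for k
      by (simp add: moments vector_state[OF YM])
    show "Poly_Mapping.lookup p w = 0" if "w \<notin> words m (Suc d)" for w
      using W that by (metis in_keys_iff subsetD)
    show "\<pi> Y = word_sum (Suc d) (Poly_Mapping.lookup p)"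
      by (rule ext) (simp add: Y eval[OF p W])
  qed
  obtain w where w: "w \<noteq> []" "Poly_Mapping.lookup p w \<noteq> 0"
  proof (rule ccontr)
    assume "\<not> thesis"
    with that have "Poly_Mapping.keys p \<subseteq> {[]}" by (auto simp: in_keys_iff)
    then have "Y = (\<lambda>v. Poly_Mapping.lookup p [] *\<^sub>C v)"
      unfolding Y by (intro ext) (simp add: nc_eval_eq_sum[of "{[]}"] nc_monomial_Nil)
    with assms(9) show False by blast
  qed
  show ?thesis
  proof (rule distribution_absolutely_continuous[OF w])
    fix j assume "j \<in> {1..m}"
    then obtain l where l: "nc_eval y (nc_number j p) = (\<lambda>v. l *\<^sub>C Y v)"
      using assms(11) number by metis
    have "word_sum (Suc d) (\<lambda>u. of_nat (count_list u j) * Poly_Mapping.lookup p u) v = l *\<^sub>C \<pi> Y v" for v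
    proof -
      have "Poly_Mapping.keys (nc_number j p) \<subseteq> words m (Suc d)" using keys_nc_number W by blast
      from eval[OF number_poly[OF p] this, of v] show ?thesis
        by (simp add: l \<pi>_scaleC[OF YM] lookup_nc_number word_sum_def)
    qed
    then show "\<exists>l. \<forall>v. word_sum (Suc d) (\<lambda>u. of_nat (count_list u j) * Poly_Mapping.lookup p u) v
        = l *\<^sub>C \<pi> Y v" by blast
  qed
qed

end
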